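(* Assume that $\mathbb{E}[|f_i(t_j)|]+\mathbb{E}[|g_i(t_j)|]<\infty$ for all $i=1,\dots,n$ and $j=0,\dots,m$, and that $f_1(t_j,\omega)<\cdots<f_n(t_j,\omega)$ for all $(t_j,\omega)\in\pi\times\Omega$. For $L\in\mathcal{L}^{\pi,+}$ set $$J^\pi(L):=\mathbb{E}\Big[\sum_{i=1}^n\Big(\int_{[0,T]}\big(g_i(t)\mathbf 1_{\{L_{t-}<i\}}\,\mu^{P,\pi}(dt)-f(t,L_{t-})\mathbf 1_{\{L_{t-}\ge i\}}\,\mu^{A,\pi}(dt)\big)-\xi\Big)\Big].$$ Then, with $\tau_{n+1}\equiv T$, $$V^{P,\pi}=\sup_{L\in\mathcal{L}^{\pi,+}}J^\pi(L)=\sup_{L\in\mathcal{L}^{\pi,+}_0}J^\pi(L)=\sup_{\substack{\{\tau_i\}_{i=1}^n\subset\mathcal{T}^\pi\\ \tau_1\le\cdots\le\tau_n}}\mathbb{E}\Big[\sum_{i=1}^n\Big(\int_{[0,\tau_i]}g_i(t)\,\mu^{P,\pi}(dt)-\sum_{j=i}^n\int_{(\tau_j,\tau_{j+1}]}f_j(t)\,\mu^{A,\pi}(dt)-\xi\Big)\Big].$$ Moreover, there exists an optimal contract for the problem defining $V^{P,\pi}$, i.e. some $Y\in\mathcal{Y}^\pi$ attains the supremum in its definition.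
   Context: Setting: $(\Omega,\mathcal{F},\mathbb{P})$ is a complete probability space with a filtration $\mathbb{F}=(\mathcal{F}_t)_{t\in[0,T]}$ satisfying the usual conditions, $0<T<\infty$. $n\ge1$ is an integer (number of agents); $f_i,g_i:[0,T]\times\Omega\to\mathbb{R}$, $i=1,\dots,n$, are progressively measurable; $\xi$ is an $\mathcal{F}_T$-measurable random variable with $\mathbb{E}|\xi|<\infty$. $\pi=(t_j)_{0\le j\le m}$ is a partition $0=t_0<t_1<\cdots<t_m=T$. Filtration $\mathbb{F}^\pi=(\mathcal{F}^\pi_t)_{t\in[0,T]}$: $\mathcal{F}^\pi_t:=\mathcal{F}_{t_j}$ for $t\in[t_j,t_{j+1})$, $j=0,\dots,m-1$, and $\mathcal{F}^\pi_T:=\mathcal{F}_T$. $\mathcal{T}^\pi$ is the set of $\mathbb{F}^\pi$-stopping times with values in $\pi$. Measures: $\mu^{A,\pi}(dt)=\sum_{j=0}^m c^A_j\delta_{t_j}(dt)$ and $\mu^{P,\pi}(dt)=\sum_{j=0}^m c^P_j\delta_{t_j}(dt)$ with constants $c^A_j,c^P_j>0$. Admissible contracts: $\mathcal{Y}^\pi$ is the set of $\mathbb{F}^\pi$-adapted processes $Y$ such that $Y_t=Y_{t_j}$ for $t\in[t_j,t_{j+1})$, $\mathbb{E}[|Y_{t_j}|]<\infty$ for $j=0,\dots,m$, and $Y_T\ge\xi$. Agents: given $Y\in\mathcal{Y}^\pi$, agent $i$ solves $\sup_{\tau\in\mathcal{T}^\pi}\mathbb{E}\big[\int_{[0,\tau]}f_i(t)\,\mu^{A,\pi}(dt)+Y_\tau\big]$,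 and $\hat\tau_i=\hat\tau_i(Y)\in\mathcal{T}^\pi$ denotes its smallest optimal stopping time. Contract design problem: $V^{P,\pi}:=\sup_{Y\in\mathcal{Y}^\pi}\mathbb{E}\big[\sum_{i=1}^n\big(\int_{[0,\hat\tau_i]}g_i(t)\,\mu^{P,\pi}(dt)-Y_{\hat\tau_i}\big)\big]$. Interpolation: $f:[0,T]\times\Omega\times\mathbb{R}\to\mathbb{R}$ is $f(t,\omega,\ell)=f_1(t,\omega)+(\ell-1)$ for $\ell\le1$; $f(t,\omega,\ell)=(i+1-\ell)f_i(t,\omega)+(\ell-i)f_{i+1}(t,\omega)$ for $\ell\in[i,i+1]$, $i=1,\dots,n-1$; $f(t,\omega,\ell)=f_n(t,\omega)+(\ell-n)$ for $\ell\ge n$. Controls: $\mathcal{L}^\pi$ is the set of $\mathbb{F}^\pi$-optional processes $L:[0,T]\times\Omega\to[0,n]$ constant on each interval $[t_j,t_{j+1})$; $\mathcal{L}^{\pi,+}$ is the set of $L\in\mathcal{L}^\pi$ with non-decreasing paths; $\mathcal{L}^{\pi,+}_0$ is the set of $L\in\mathcal{L}^{\pi,+}$ with $L_t\in\{0,1,\dots,n\}$ for all $t$, a.s. $L_{t-}$ is the left limit, with the convention $L_{0-}:=0$. *)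

theory Defs
  imports "HOL-Probability.Probability"
begin

section \<open>Filtrations and processes on a bounded time interval\<close>

text \<open>Processes and filtrations are indexed by \<^typ>\<open>real\<close>; only their values at times in
  \<open>[0,T]\<close> (and at points of \<open>space M\<close>) are constrained or used.\<close>

definition usual_filtration :: "'w measure \<Rightarrow> real \<Rightarrow> (real \<Rightarrow> 'w measure) \<Rightarrow> bool" where
  "usual_filtration M T F \<longleftrightarrow>
     (\<forall>t\<in>{0..T}. subalgebra M (F t)) \<and>
     (\<forall>s\<in>{0..T}. \<forall>t\<in>{s..T}. sets (F s) \<subseteq> sets (F t)) \<and>
     (\<forall>t\<in>{0..<T}. sets (F t) = (\<Inter>s\<in>{t<..T}. sets (F s))) \<and>
     null_sets M \<subseteq> sets (F 0)"

definition progressively_measurable ::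
    "real \<Rightarrow> (real \<Rightarrow> 'w measure) \<Rightarrow> (real \<Rightarrow> 'w \<Rightarrow> real) \<Rightarrow> bool" where
  "progressively_measurable T F X \<longleftrightarrow>
     (\<forall>t\<in>{0..T}. (\<lambda>(s, \<omega>). X s \<omega>) \<in> borel_measurable (restrict_space borel {0..t} \<Otimes>\<^sub>M F t))"

definition adapted :: "real \<Rightarrow> (real \<Rightarrow> 'w measure) \<Rightarrow> (real \<Rightarrow> 'w \<Rightarrow> real) \<Rightarrow> bool" where
  "adapted T F X \<longleftrightarrow> (\<forall>t\<in>{0..T}. X t \<in> borel_measurable (F t))"

definition cadlag_paths :: "'w measure \<Rightarrow> real \<Rightarrow> (real \<Rightarrow> 'w \<Rightarrow> real) \<Rightarrow> bool" where
  "cadlag_paths M T X \<longleftrightarrow> (\<forall>\<omega>\<in>space M.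
     (\<forall>t\<in>{0..<T}. ((\<lambda>s. X s \<omega>) \<longlongrightarrow> X t \<omega>) (at_right t)) \<and>
     (\<forall>t\<in>{0<..T}. \<exists>l. ((\<lambda>s. X s \<omega>) \<longlongrightarrow> l) (at_left t)))"

definition optional_sigma :: "'w measure \<Rightarrow> real \<Rightarrow> (real \<Rightarrow> 'w measure) \<Rightarrow> (real \<times> 'w) measure" where
  "optional_sigma M T F = sigma ({0..T} \<times> space M)
     {{(t, \<omega>) \<in> {0..T} \<times> space M. X t \<omega> \<in> B} | X B.
        adapted T F X \<and> cadlag_paths M T X \<and> B \<in> sets borel}"

definition optional_process ::
    "'w measure \<Rightarrow> real \<Rightarrow> (real \<Rightarrow> 'w measure) \<Rightarrow> (real \<Rightarrow> 'w \<Rightarrow> real) \<Rightarrow> bool" where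
  "optional_process M T F X \<longleftrightarrow> (\<lambda>(t, \<omega>). X t \<omega>) \<in> borel_measurable (optional_sigma M T F)"

text \<open>The left limit, with the convention that a process vanishes at time \<open>0-\<close>.\<close>

definition left_limit :: "(real \<Rightarrow> 'w \<Rightarrow> real) \<Rightarrow> real \<Rightarrow> 'w \<Rightarrow> real" where
  "left_limit X t \<omega> = (if t \<le> 0 then 0 else Lim (at_left t) (\<lambda>s. X s \<omega>))"


section \<open>The partition\<close>

definition partition_of :: "real \<Rightarrow> nat \<Rightarrow> (nat \<Rightarrow> real) \<Rightarrow> bool" where
  "partition_of T m p \<longleftrightarrow> p 0 = 0 \<and> p m = T \<and> (\<forall>j<m. p j < p (Suc j))"

text \<open>\<open>grid_filtration F m p t\<close> is \<open>F (p j)\<close> for the largest \<open>j \<le> m\<close> with \<open>p j \<le> t\<close>. It is thereby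
  extended to all real times, constantly to the left of \<open>0\<close> and to the right of \<open>p m\<close>. For random
  times with values in \<open>[0, p m]\<close> the extension adds no condition to \<^const>\<open>stopping_time\<close>.\<close>

definition grid_filtration :: "(real \<Rightarrow> 'w measure) \<Rightarrow> nat \<Rightarrow> (nat \<Rightarrow> real) \<Rightarrow> real \<Rightarrow> 'w measure" where
  "grid_filtration F m p t = F (p (Max (insert 0 {j. j \<le> m \<and> p j \<le> t})))"

lemma partition_of_mono:
  assumes "partition_of T m p" "i \<le> j" "j \<le> m"
  shows "p i \<le> p j"
  using assms(2,3)
proof (induction j rule: dec_induct)
  case (step k)
  then show ?case using assms(1) unfolding partition_of_def
    by (metis Suc_leD Suc_le_lessD less_imp_le order_trans)
qed simp

lemma grid_filtration_eq:
  assumes P: "partition_of T m p" and "j < m" "t \<in> {p j..<p (Suc j)}"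
  shows "grid_filtration F m p t = F (p j)"
proof -
  have "k \<le> j" if "k \<le> m" "p k \<le> t" for k
    using partition_of_mono[OF P, of "Suc j" k] that assms by force
  then have "Max (insert 0 {k. k \<le> m \<and> p k \<le> t}) = j"
    using assms by (intro Max_eqI) auto
  then show ?thesis by (simp add: grid_filtration_def)
qed

lemma grid_filtration_end:
  assumes "partition_of T m p"
  shows "grid_filtration F m p T = F T"
proof -
  have "Max (insert 0 {k. k \<le> m \<and> p k \<le> T}) = m"
    using assms by (intro Max_eqI) (auto simp: partition_of_def)
  then show ?thesis using assms by (simp add: grid_filtration_def partition_of_def)
qed

definition grid_stopping_times ::
    "'w measure \<Rightarrow> (real \<Rightarrow> 'w measure) \<Rightarrow> nat \<Rightarrow> (nat \<Rightarrow> real) \<Rightarrow> ('w \<Rightarrow> real) set" where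
  "grid_stopping_times M F m p =
     {\<tau>. stopping_time (grid_filtration F m p) \<tau> \<and> (\<forall>\<omega>\<in>space M. \<tau> \<omega> \<in> p ` {..m})}"

definition constant_between ::
    "'w measure \<Rightarrow> nat \<Rightarrow> (nat \<Rightarrow> real) \<Rightarrow> (real \<Rightarrow> 'w \<Rightarrow> real) \<Rightarrow> bool" where
  "constant_between M m p X \<longleftrightarrow>
     (\<forall>j<m. \<forall>t\<in>{p j..<p (Suc j)}. \<forall>\<omega>\<in>space M. X t \<omega> = X (p j) \<omega>)"

text \<open>The Borel measure with mass \<open>c j\<close> at the point \<open>p j\<close>, see \<open>emeasure_grid_measure\<close>.\<close>

definition grid_measure :: "nat \<Rightarrow> (nat \<Rightarrow> real) \<Rightarrow> (nat \<Rightarrow> real) \<Rightarrow> real measure" where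
  "grid_measure m p c = distr (point_measure {..m} (\<lambda>j. ennreal (c j))) borel p"

lemma emeasure_grid_measure:
  assumes "A \<in> sets borel"
  shows "emeasure (grid_measure m p c) A = (\<Sum>j\<le>m. ennreal (c j) * indicator A (p j))"
proof -
  have "emeasure (grid_measure m p c) A = (\<Sum>j\<in>p -` A \<inter> {..m}. ennreal (c j))"
    using assms unfolding grid_measure_def
    by (subst emeasure_distr)
       (auto simp: space_point_measure measurable_point_measure_eq1 emeasure_point_measure_finite)
  also have "\<dots> = (\<Sum>j\<le>m. ennreal (c j) * indicator A (p j))"
    by (intro sum.mono_neutral_cong_left) (auto simp: indicator_def)
  finally show ?thesis .
qed


section \<open>Agents and the principal\<close>

definition contracts ::
    "'w measure \<Rightarrow> real \<Rightarrow> (real \<Rightarrow> 'w measure) \<Rightarrow> nat \<Rightarrow> (nat \<Rightarrow> real) \<Rightarrow> ('w \<Rightarrow> real)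
       \<Rightarrow> (real \<Rightarrow> 'w \<Rightarrow> real) set" where
  "contracts M T F m p \<xi> =
     {Y. adapted T (grid_filtration F m p) Y \<and> constant_between M m p Y \<and>
         (\<forall>j\<le>m. integrable M (Y (p j))) \<and> (\<forall>\<omega>\<in>space M. Y T \<omega> \<ge> \<xi> \<omega>)}"

text \<open>In the following, \<open>\<mu>A\<close> and \<open>\<mu>P\<close> are the time measures of the agents and of the principal.\<close>

definition agent_payoff ::
    "'w measure \<Rightarrow> real measure \<Rightarrow> (real \<Rightarrow> 'w \<Rightarrow> real) \<Rightarrow> (real \<Rightarrow> 'w \<Rightarrow> real) \<Rightarrow> ('w \<Rightarrow> real) \<Rightarrow> real" where
  "agent_payoff M \<mu>A h Y \<tau> =
     (LINT \<omega>|M. (LINT t:{0..\<tau> \<omega>}|\<mu>A. h t \<omega>) + Y (\<tau> \<omega>) \<omega>)"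

definition optimal_stopping_time ::
    "'w measure \<Rightarrow> (real \<Rightarrow> 'w measure) \<Rightarrow> nat \<Rightarrow> (nat \<Rightarrow> real) \<Rightarrow> real measure
       \<Rightarrow> (real \<Rightarrow> 'w \<Rightarrow> real) \<Rightarrow> (real \<Rightarrow> 'w \<Rightarrow> real) \<Rightarrow> ('w \<Rightarrow> real) \<Rightarrow> bool" where
  "optimal_stopping_time M F m p \<mu>A h Y \<tau> \<longleftrightarrow>
     \<tau> \<in> grid_stopping_times M F m p \<and>
     (\<forall>\<sigma>\<in>grid_stopping_times M F m p. agent_payoff M \<mu>A h Y \<sigma> \<le> agent_payoff M \<mu>A h Y \<tau>)"

text \<open>The smallest optimal stopping time is determined up to a null set only, which affects none of
  the expectations below; an arbitrary version is chosen.\<close>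

definition smallest_optimal_time ::
    "'w measure \<Rightarrow> (real \<Rightarrow> 'w measure) \<Rightarrow> nat \<Rightarrow> (nat \<Rightarrow> real) \<Rightarrow> real measure
       \<Rightarrow> (real \<Rightarrow> 'w \<Rightarrow> real) \<Rightarrow> (real \<Rightarrow> 'w \<Rightarrow> real) \<Rightarrow> ('w \<Rightarrow> real)" where
  "smallest_optimal_time M F m p \<mu>A h Y =
     (SOME \<tau>. optimal_stopping_time M F m p \<mu>A h Y \<tau> \<and>
        (\<forall>\<sigma>. optimal_stopping_time M F m p \<mu>A h Y \<sigma> \<longrightarrow> (AE \<omega> in M. \<tau> \<omega> \<le> \<sigma> \<omega>)))"

definition principal_payoff ::
    "'w measure \<Rightarrow> (real \<Rightarrow> 'w measure) \<Rightarrow> nat \<Rightarrow> (nat \<Rightarrow> real) \<Rightarrow> real measure \<Rightarrow> real measure \<Rightarrow> nat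
       \<Rightarrow> (nat \<Rightarrow> real \<Rightarrow> 'w \<Rightarrow> real) \<Rightarrow> (nat \<Rightarrow> real \<Rightarrow> 'w \<Rightarrow> real) \<Rightarrow> (real \<Rightarrow> 'w \<Rightarrow> real) \<Rightarrow> real" where
  "principal_payoff M F m p \<mu>A \<mu>P n f g Y =
     (LINT \<omega>|M. (\<Sum>i=1..n.
        let \<tau> = smallest_optimal_time M F m p \<mu>A (f i) Y
        in (LINT t:{0..\<tau> \<omega>}|\<mu>P. g i t \<omega>) - Y (\<tau> \<omega>) \<omega>))"

definition principal_value ::
    "'w measure \<Rightarrow> real \<Rightarrow> (real \<Rightarrow> 'w measure) \<Rightarrow> nat \<Rightarrow> (nat \<Rightarrow> real) \<Rightarrow> real measure \<Rightarrow> real measure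
       \<Rightarrow> nat \<Rightarrow> (nat \<Rightarrow> real \<Rightarrow> 'w \<Rightarrow> real) \<Rightarrow> (nat \<Rightarrow> real \<Rightarrow> 'w \<Rightarrow> real) \<Rightarrow> ('w \<Rightarrow> real) \<Rightarrow> ereal" where
  "principal_value M T F m p \<mu>A \<mu>P n f g \<xi> =
     (SUP Y\<in>contracts M T F m p \<xi>. ereal (principal_payoff M F m p \<mu>A \<mu>P n f g Y))"


section \<open>Controls\<close>

definition interpolation ::
    "nat \<Rightarrow> (nat \<Rightarrow> real \<Rightarrow> 'w \<Rightarrow> real) \<Rightarrow> real \<Rightarrow> 'w \<Rightarrow> real \<Rightarrow> real" where
  "interpolation n f t \<omega> l =
     (if l \<le> 1 then f 1 t \<omega> + (l - 1)
      else if l \<ge> real n then f n t \<omega> + (l - real n)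
      else let i = nat \<lfloor>l\<rfloor>
           in (real i + 1 - l) * f i t \<omega> + (l - real i) * f (Suc i) t \<omega>)"

definition controls ::
    "'w measure \<Rightarrow> real \<Rightarrow> (real \<Rightarrow> 'w measure) \<Rightarrow> nat \<Rightarrow> (nat \<Rightarrow> real) \<Rightarrow> nat
       \<Rightarrow> (real \<Rightarrow> 'w \<Rightarrow> real) set" where
  "controls M T F m p n =
     {L. optional_process M T (grid_filtration F m p) L \<and>
         (\<forall>t\<in>{0..T}. \<forall>\<omega>\<in>space M. L t \<omega> \<in> {0..real n}) \<and> constant_between M m p L}"

definition monotone_controls ::
    "'w measure \<Rightarrow> real \<Rightarrow> (real \<Rightarrow> 'w measure) \<Rightarrow> nat \<Rightarrow> (nat \<Rightarrow> real) \<Rightarrow> nat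
       \<Rightarrow> (real \<Rightarrow> 'w \<Rightarrow> real) set" where
  "monotone_controls M T F m p n =
     {L \<in> controls M T F m p n. \<forall>\<omega>\<in>space M. mono_on {0..T} (\<lambda>t. L t \<omega>)}"

definition integer_controls ::
    "'w measure \<Rightarrow> real \<Rightarrow> (real \<Rightarrow> 'w measure) \<Rightarrow> nat \<Rightarrow> (nat \<Rightarrow> real) \<Rightarrow> nat
       \<Rightarrow> (real \<Rightarrow> 'w \<Rightarrow> real) set" where
  "integer_controls M T F m p n =
     {L \<in> monotone_controls M T F m p n. AE \<omega> in M. \<forall>t\<in>{0..T}. L t \<omega> \<in> real ` {0..n}}"

definition control_payoff ::
    "'w measure \<Rightarrow> real \<Rightarrow> real measure \<Rightarrow> real measure \<Rightarrow> nat \<Rightarrow> (nat \<Rightarrow> real \<Rightarrow> 'w \<Rightarrow> real)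
       \<Rightarrow> (nat \<Rightarrow> real \<Rightarrow> 'w \<Rightarrow> real) \<Rightarrow> ('w \<Rightarrow> real) \<Rightarrow> (real \<Rightarrow> 'w \<Rightarrow> real) \<Rightarrow> real" where
  "control_payoff M T \<mu>A \<mu>P n f g \<xi> L =
     (LINT \<omega>|M. (\<Sum>i=1..n.
        (LINT t:{0..T}|\<mu>P. g i t \<omega> * of_bool (left_limit L t \<omega> < real i))
        - (LINT t:{0..T}|\<mu>A. interpolation n f t \<omega> (left_limit L t \<omega>)
                             * of_bool (left_limit L t \<omega> \<ge> real i))
        - \<xi> \<omega>))"


section \<open>Ordered families of stopping times\<close>

text \<open>The time with index \<open>n + 1\<close> is the constant \<open>T\<close>.\<close>

definition ordered_stopping_times ::
    "'w measure \<Rightarrow> real \<Rightarrow> (real \<Rightarrow> 'w measure) \<Rightarrow> nat \<Rightarrow> (nat \<Rightarrow> real) \<Rightarrow> nat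
       \<Rightarrow> (nat \<Rightarrow> 'w \<Rightarrow> real) set" where
  "ordered_stopping_times M T F m p n =
     {\<tau>. (\<forall>i\<in>{1..n}. \<tau> i \<in> grid_stopping_times M F m p) \<and>
         (\<forall>i\<in>{1..<n}. \<forall>\<omega>\<in>space M. \<tau> i \<omega> \<le> \<tau> (Suc i) \<omega>) \<and>
         \<tau> (Suc n) = (\<lambda>_. T)}"

definition stopping_payoff ::
    "'w measure \<Rightarrow> real measure \<Rightarrow> real measure \<Rightarrow> nat \<Rightarrow> (nat \<Rightarrow> real \<Rightarrow> 'w \<Rightarrow> real)
       \<Rightarrow> (nat \<Rightarrow> real \<Rightarrow> 'w \<Rightarrow> real) \<Rightarrow> ('w \<Rightarrow> real) \<Rightarrow> (nat \<Rightarrow> 'w \<Rightarrow> real) \<Rightarrow> real" where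
  "stopping_payoff M \<mu>A \<mu>P n f g \<xi> \<tau> =
     (LINT \<omega>|M. (\<Sum>i=1..n.
        (LINT t:{0..\<tau> i \<omega>}|\<mu>P. g i t \<omega>)
        - (\<Sum>j=i..n. LINT t:{\<tau> j \<omega><..\<tau> (Suc j) \<omega>}|\<mu>A. f j t \<omega>)
        - \<xi> \<omega>))"

end

theory Submission
  imports Defs
begin

text \<open>All measures in time are carried by the grid, so each of the four problems is a problem about finite sums.
The hub is the last one, over ordered families of stopping times; the others are compared with it.

The principal earns no more than some ordered family. Since the running payoffs increase
with the index of the agent, an exchange argument orders the agents' optimal times
(\<open>optimal_times_ordered\<close>). Agent \<open>i\<close> could wait until agent \<open>i + 1\<close> stops and does not gain
from it, so the expected payment to agent \<open>i\<close> exceeds the one to agent \<open>i + 1\<close> at least by the expected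
accrual of \<open>f i\<close> in between. Telescoping down to the terminal payment, which is at least \<open>\<xi>\<close>, bounds
the total cost from below (\<open>principal_payoff_le\<close>).

The principal can earn what an ordered family \<open>\<tau>\<close> yields. Let \<open>N s\<close> be the number of agents who stop
before time \<open>s\<close>, and offer at time \<open>t\<close> the conditional expectation of \<open>\<xi>\<close> plus the accrual of
the interpolation at \<open>N s\<close> over \<open>s\<close> in \<open>(t, T]\<close>. For agent \<open>i\<close>, the expected gain from a stopping time
is then a constant plus the expected accrual of \<open>f i\<close> minus the interpolation at \<open>N\<close>. The accrued difference is
positive as long as fewer than \<open>i\<close> agents have stopped, that is up to \<open>\<tau> i\<close>, and nonpositive
afterwards. So \<open>\<tau> i\<close> is the smallest optimal time (\<open>best_time_implementing_contract\<close>), and the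
lower bound on the cost is attained (\<open>principal_payoff_implementing_contract\<close>).

Ordered families and monotone controls are translated into each other by counting and level crossing. A family
gives the integer control that counts the agents who have stopped. A monotone control \<open>L\<close> gives the
first grid times at which \<open>L\<close> reaches the levels \<open>1, \<dots>, n\<close>. The passage from \<open>L\<close> to these times rounds \<open>L\<close>
down, which leaves the gain terms unchanged and cannot raise the cost, because the interpolation
increases in its last argument (\<open>control_payoff_level_times\<close>).

There remains existence: of smallest optimal stopping times for the agents, and of an optimal
ordered family for the principal. In both cases the reward is a sum of functions of single times,
hence modular on the lattice of admissible families. Therefore maxima of nearly
optimal families are nearly optimal, and the limit superior of a fast maximising sequence is optimal
(\<open>maximiser_exists\<close>). The maximisers again form such a lattice; one of least expected time is
almost surely the smallest (\<open>smallest_maximiser_exists\<close>).\<close>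

section \<open>Maximisation over a lattice of finitely valued times\<close>

lemma monotone_finite_range_eventually_const:
  fixes a :: "nat \<Rightarrow> real"
  assumes "finite S" "range a \<subseteq> S" "incseq a \<or> decseq a"
  shows "\<exists>l. \<forall>\<^sub>F k in sequentially. a k = l"
proof -
  have fin: "finite (range a)" using assms finite_subset by blast
  show ?thesis
  proof (cases "incseq a")
    case True
    obtain N where N: "a N = Max (range a)" using Max_in[OF fin] by auto
    have "a k = a N" if "k \<ge> N" for k
      using Max_ge[OF fin, of "a k"] N incseqD[OF True that] by auto
    then show ?thesis unfolding eventually_sequentially by blast
  next
    case False
    then have dec: "decseq a" using assms by blast
    obtain N where N: "a N = Min (range a)" using Min_in[OF fin] by auto
    have "a k = a N" if "k \<ge> N" for k
      using Min_le[OF fin, of "a k"] N decseqD[OF dec that] by auto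
    then show ?thesis unfolding eventually_sequentially by blast
  qed
qed

lemma finitely_valued_sum:
  assumes "finite S" "t \<in> S"
  shows "(R t :: real) = (\<Sum>s\<in>S. of_bool (t = s) * R s)"
  using assms by (subst sum.remove[of _ t]) (auto intro!: sum.neutral)

lemma integrable_at_finitely_valued_time:
  fixes R :: "real \<Rightarrow> 'w \<Rightarrow> real"
  assumes S: "finite S" and \<tau>: "\<tau> \<in> borel_measurable M" "\<And>\<omega>. \<omega> \<in> space M \<Longrightarrow> \<tau> \<omega> \<in> S"
    and R: "\<And>s. s \<in> S \<Longrightarrow> integrable M (R s)"
  shows "integrable M (\<lambda>\<omega>. R (\<tau> \<omega>) \<omega>)"
    and "(LINT \<omega>|M. R (\<tau> \<omega>) \<omega>) = (\<Sum>s\<in>S. LINT \<omega>|M. indicator {\<omega>\<in>space M. \<tau> \<omega> = s} \<omega> * R s \<omega>)"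
proof -
  have set: "{\<omega>\<in>space M. \<tau> \<omega> = s} \<in> sets M" for s
    using \<tau>(1) by measurable
  have int: "integrable M (\<lambda>\<omega>. indicator {\<omega>\<in>space M. \<tau> \<omega> = s} \<omega> * R s \<omega>)" if "s \<in> S" for s
    using integrable_mult_indicator[OF set R[OF that]] by simp
  have eq: "R (\<tau> \<omega>) \<omega> = (\<Sum>s\<in>S. indicator {\<omega>\<in>space M. \<tau> \<omega> = s} \<omega> * R s \<omega>)"
    if "\<omega> \<in> space M" for \<omega>
    by (subst finitely_valued_sum[OF S \<tau>(2)[OF that], of "\<lambda>s. R s \<omega>"])
       (use that in \<open>auto intro!: sum.cong simp: indicator_def\<close>)
  show "integrable M (\<lambda>\<omega>. R (\<tau> \<omega>) \<omega>)"
    by (subst Bochner_Integration.integrable_cong[OF refl eq]) (use int in auto)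
  have "(LINT \<omega>|M. R (\<tau> \<omega>) \<omega>) = (LINT \<omega>|M. (\<Sum>s\<in>S. indicator {\<omega>\<in>space M. \<tau> \<omega> = s} \<omega> * R s \<omega>))"
    by (rule Bochner_Integration.integral_cong[OF refl eq])
  then show "(LINT \<omega>|M. R (\<tau> \<omega>) \<omega>)
      = (\<Sum>s\<in>S. LINT \<omega>|M. indicator {\<omega>\<in>space M. \<tau> \<omega> = s} \<omega> * R s \<omega>)"
    using int by (simp add: Bochner_Integration.integral_sum)
qed

text \<open>The common abstraction of the two existence problems. \<open>X\<close> indexes the components of a family of random times: a
single component for an agent, one component per agent for the principal. The closure under
pointwise eventually constant limits covers all the limits that are required, because monotone sequences in a
finite set are eventually constant.\<close>

locale time_lattice =
  fixes M :: "'w measure" and X :: "'x set" and S :: "real set" and C :: "('x \<Rightarrow> 'w \<Rightarrow> real) set"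
  assumes finite_X: "finite X" and finite_S: "finite S" and C_nonempty: "C \<noteq> {}"
    and C_values: "\<And>\<tau> x \<omega>. \<tau> \<in> C \<Longrightarrow> x \<in> X \<Longrightarrow> \<omega> \<in> space M \<Longrightarrow> \<tau> x \<omega> \<in> S"
    and C_measurable: "\<And>\<tau> x. \<tau> \<in> C \<Longrightarrow> x \<in> X \<Longrightarrow> \<tau> x \<in> borel_measurable M"
    and C_max: "\<And>\<sigma> \<tau>. \<sigma> \<in> C \<Longrightarrow> \<tau> \<in> C \<Longrightarrow> (\<lambda>x \<omega>. max (\<sigma> x \<omega>) (\<tau> x \<omega>)) \<in> C"
    and C_min: "\<And>\<sigma> \<tau>. \<sigma> \<in> C \<Longrightarrow> \<tau> \<in> C \<Longrightarrow> (\<lambda>x \<omega>. min (\<sigma> x \<omega>) (\<tau> x \<omega>)) \<in> C"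
    and C_limit: "\<And>s t. (\<And>k. s k \<in> C) \<Longrightarrow>
      (\<And>x \<omega>. x \<in> X \<Longrightarrow> \<omega> \<in> space M \<Longrightarrow> \<forall>\<^sub>F k in sequentially. s k x \<omega> = t x \<omega>) \<Longrightarrow> t \<in> C"
begin

definition reward :: "('x \<Rightarrow> real \<Rightarrow> 'w \<Rightarrow> real) \<Rightarrow> ('x \<Rightarrow> 'w \<Rightarrow> real) \<Rightarrow> real" where
  "reward H \<tau> = (LINT \<omega>|M. (\<Sum>x\<in>X. H x (\<tau> x \<omega>) \<omega>))"

definition integrable_rewards :: "('x \<Rightarrow> real \<Rightarrow> 'w \<Rightarrow> real) \<Rightarrow> bool" where
  "integrable_rewards H \<longleftrightarrow> (\<forall>x\<in>X. \<forall>s\<in>S. integrable M (H x s))"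

lemma integrable_reward:
  assumes "integrable_rewards H" "\<tau> \<in> C"
  shows "integrable M (\<lambda>\<omega>. \<Sum>x\<in>X. H x (\<tau> x \<omega>) \<omega>)"
proof (rule Bochner_Integration.integrable_sum)
  fix x assume x: "x \<in> X"
  show "integrable M (\<lambda>\<omega>. H x (\<tau> x \<omega>) \<omega>)"
    by (rule integrable_at_finitely_valued_time(1)[OF finite_S, where R = "H x" and \<tau> = "\<tau> x"])
       (use assms x in \<open>auto simp: integrable_rewards_def C_measurable C_values\<close>)
qed

definition envelope :: "('x \<Rightarrow> real \<Rightarrow> 'w \<Rightarrow> real) \<Rightarrow> 'w \<Rightarrow> real" where
  "envelope H \<omega> = (\<Sum>x\<in>X. \<Sum>s\<in>S. \<bar>H x s \<omega>\<bar>)"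

lemma reward_le_envelope:
  assumes "\<tau> \<in> C" "\<omega> \<in> space M"
  shows "\<bar>\<Sum>x\<in>X. H x (\<tau> x \<omega>) \<omega>\<bar> \<le> envelope H \<omega>"
  unfolding envelope_def using C_values[OF assms(1) _ assms(2)] finite_S
  by (intro order_trans[OF sum_abs] sum_mono) (auto intro: member_le_sum)

lemma integrable_envelope: "integrable_rewards H \<Longrightarrow> integrable M (envelope H)"
  unfolding envelope_def[abs_def] integrable_rewards_def by auto

lemma reward_bounded:
  assumes "integrable_rewards H" "\<tau> \<in> C"
  shows "reward H \<tau> \<le> integral\<^sup>L M (envelope H)"
  unfolding reward_def
proof (rule integral_mono[OF integrable_reward[OF assms] integrable_envelope[OF assms(1)]])
  show "(\<Sum>x\<in>X. H x (\<tau> x \<omega>) \<omega>) \<le> envelope H \<omega>" if "\<omega> \<in> space M" for \<omega>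
    using reward_le_envelope[OF assms(2) that, of H] by linarith
qed

text \<open>Pathwise and for each component, the maximum and the minimum are the two given times in some order,
and the reward is a sum over the components.\<close>

lemma reward_modular:
  assumes H: "integrable_rewards H" and "\<sigma> \<in> C" "\<tau> \<in> C"
  shows "reward H (\<lambda>x \<omega>. max (\<sigma> x \<omega>) (\<tau> x \<omega>)) + reward H (\<lambda>x \<omega>. min (\<sigma> x \<omega>) (\<tau> x \<omega>))
       = reward H \<sigma> + reward H \<tau>"
proof -
  let ?R = "\<lambda>\<tau> \<omega>. \<Sum>x\<in>X. H x (\<tau> x \<omega>) \<omega>"
  let ?M = "\<lambda>x \<omega>. max (\<sigma> x \<omega>) (\<tau> x \<omega>)" and ?m = "\<lambda>x \<omega>. min (\<sigma> x \<omega>) (\<tau> x \<omega>)"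
  have "?R ?M \<omega> + ?R ?m \<omega> = ?R \<sigma> \<omega> + ?R \<tau> \<omega>" for \<omega>
    unfolding sum.distrib[symmetric] by (intro sum.cong) (auto simp: max_def min_def)
  then have "(LINT \<omega>|M. ?R ?M \<omega> + ?R ?m \<omega>) = (LINT \<omega>|M. ?R \<sigma> \<omega> + ?R \<tau> \<omega>)" by simp
  then show ?thesis
    unfolding reward_def
    using Bochner_Integration.integral_add[OF integrable_reward[OF H C_max[OF assms(2,3)]]
        integrable_reward[OF H C_min[OF assms(2,3)]]]
      Bochner_Integration.integral_add[OF integrable_reward[OF H assms(2)] integrable_reward[OF H assms(3)]]
    by simp
qed

lemma reward_tendsto:
  assumes H: "integrable_rewards H" and s: "\<And>k. s k \<in> C"
    and lim: "\<And>x \<omega>. x \<in> X \<Longrightarrow> \<omega> \<in> space M \<Longrightarrow> \<forall>\<^sub>F k in sequentially. s k x \<omega> = t x \<omega>"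
  shows "(\<lambda>k. reward H (s k)) \<longlonglongrightarrow> reward H t"
  unfolding reward_def
proof (rule integral_dominated_convergence[where w = "envelope H"])
  show "(\<lambda>\<omega>. \<Sum>x\<in>X. H x (t x \<omega>) \<omega>) \<in> borel_measurable M"
    using integrable_reward[OF H C_limit[OF s lim]] by auto
  show "(\<lambda>\<omega>. \<Sum>x\<in>X. H x (s k x \<omega>) \<omega>) \<in> borel_measurable M" for k
    using integrable_reward[OF H s] by auto
  show "integrable M (envelope H)" using integrable_envelope[OF H] .
  show "AE \<omega> in M. norm (\<Sum>x\<in>X. H x (s k x \<omega>) \<omega>) \<le> envelope H \<omega>" for k
    using reward_le_envelope[OF s] by auto
  show "AE \<omega> in M. (\<lambda>k. \<Sum>x\<in>X. H x (s k x \<omega>) \<omega>) \<longlonglongrightarrow> (\<Sum>x\<in>X. H x (t x \<omega>) \<omega>)"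
  proof (rule AE_I2)
    fix \<omega> assume \<omega>: "\<omega> \<in> space M"
    have "\<forall>\<^sub>F k in sequentially. \<forall>x\<in>X. s k x \<omega> = t x \<omega>"
      using lim[OF _ \<omega>] finite_X by (simp add: eventually_ball_finite)
    then show "(\<lambda>k. \<Sum>x\<in>X. H x (s k x \<omega>) \<omega>) \<longlonglongrightarrow> (\<Sum>x\<in>X. H x (t x \<omega>) \<omega>)"
      by (intro tendsto_eventually) (auto elim!: eventually_mono)
  qed
qed

lemma monotone_limit_exists:
  assumes H: "integrable_rewards H" and s: "\<And>k. s k \<in> C"
    and mono: "\<And>x \<omega>. incseq (\<lambda>k. s k x \<omega>) \<or> decseq (\<lambda>k. s k x \<omega>)"
  obtains t where "t \<in> C" "(\<lambda>k. reward H (s k)) \<longlonglongrightarrow> reward H t"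
    and "\<And>x \<omega>. x \<in> X \<Longrightarrow> \<omega> \<in> space M \<Longrightarrow> \<forall>\<^sub>F k in sequentially. s k x \<omega> = t x \<omega>"
proof -
  have "\<exists>l. \<forall>\<^sub>F k in sequentially. s k x \<omega> = l" if "x \<in> X" "\<omega> \<in> space M" for x \<omega>
    using monotone_finite_range_eventually_const[OF finite_S _ mono] C_values[OF s that] by blast
  then have "\<forall>x \<omega>. \<exists>l. x \<in> X \<and> \<omega> \<in> space M \<longrightarrow> (\<forall>\<^sub>F k in sequentially. s k x \<omega> = l)" by blast
  then obtain t where t: "\<And>x \<omega>. x \<in> X \<Longrightarrow> \<omega> \<in> space M \<Longrightarrow> \<forall>\<^sub>F k in sequentially. s k x \<omega> = t x \<omega>"
    by metis
  show thesis
    by (rule that[OF C_limit[OF s t] reward_tendsto[OF H s t] t])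
qed

text \<open>The maximum of \<open>s N, \<dots>, s (N + r)\<close>, a finite approximation of the supremum of the tail of \<open>s\<close>.\<close>

primrec running_max :: "(nat \<Rightarrow> 'x \<Rightarrow> 'w \<Rightarrow> real) \<Rightarrow> nat \<Rightarrow> nat \<Rightarrow> 'x \<Rightarrow> 'w \<Rightarrow> real" where
  "running_max s N 0 = s N"
| "running_max s N (Suc r) = (\<lambda>x \<omega>. max (running_max s N r x \<omega>) (s (N + Suc r) x \<omega>))"

lemma running_max_shift: "running_max s (Suc N) r x \<omega> \<le> running_max s N (Suc r) x \<omega>"
proof (induction r)
  case (Suc r)
  have "running_max s (Suc N) (Suc r) x \<omega> = max (running_max s (Suc N) r x \<omega>) (s (N + Suc (Suc r)) x \<omega>)"
    by simp
  also have "\<dots> \<le> max (running_max s N (Suc r) x \<omega>) (s (N + Suc (Suc r)) x \<omega>)"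
    by (rule max.mono[OF Suc order_refl])
  also have "\<dots> = running_max s N (Suc (Suc r)) x \<omega>" by simp
  finally show ?case .
qed simp

text \<open>By modularity, passing to a maximum adds up the distances to the optimal value. For a sequence that
is optimal up to \<open>(1/2)^k\<close>, the tail suprema are therefore optimal up to twice \<open>(1/2)^N\<close>, and their
decreasing limit is optimal. No topology on random times is involved beyond dominated convergence.\<close>

lemma maximiser_exists:
  assumes H: "integrable_rewards H"
  shows "\<exists>\<tau>\<in>C. \<forall>\<sigma>\<in>C. reward H \<sigma> \<le> reward H \<tau>"
proof -
  define V where "V = (SUP \<tau>\<in>C. reward H \<tau>)"
  have bdd: "bdd_above (reward H ` C)"
    using reward_bounded[OF H] by (auto simp: bdd_above_def)
  have le_V: "reward H \<tau> \<le> V" if "\<tau> \<in> C" for \<tau>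
    unfolding V_def by (rule cSUP_upper[OF that bdd])
  have "\<exists>\<tau>\<in>C. V - (1/2)^k < reward H \<tau>" for k :: nat
    using less_cSUP_iff[OF C_nonempty bdd, of "V - (1/2)^k"] by (simp add: V_def)
  then obtain s where s: "\<And>k. s k \<in> C" "\<And>k. V - (1/2)^k < reward H (s k)"
    by metis
  have u_in: "running_max s N r \<in> C" for N r
    by (induction r) (auto intro: s C_max)
  \<comment> \<open>The distances \<open>(1/2)^k\<close> for \<open>k = N, \<dots>, N + r\<close> add up to \<open>2 * (1/2)^N - (1/2)^(N + r)\<close>.\<close>
  have u_reward: "V - 2 * (1/2)^N + (1/2)^(N + r) \<le> reward H (running_max s N r)" for N r
  proof (induction r)
    case 0
    then show ?case using s(2)[of N] by simp
  next
    case (Suc r)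
    have "(1/2::real)^(N + Suc r) = (1/2)^(N + r) / 2" by simp
    moreover have "reward H (running_max s N (Suc r))
        + reward H (\<lambda>x \<omega>. min (running_max s N r x \<omega>) (s (N + Suc r) x \<omega>))
        = reward H (running_max s N r) + reward H (s (N + Suc r))"
      using reward_modular[OF H u_in[of N r] s(1)[of "N + Suc r"]] by simp
    ultimately show ?case
      using le_V[OF C_min[OF u_in[of N r] s(1)[of "N + Suc r"]]] s(2)[of "N + Suc r"] Suc by linarith
  qed
  have "\<exists>t. t \<in> C \<and> (\<lambda>r. reward H (running_max s N r)) \<longlonglongrightarrow> reward H t \<and>
     (\<forall>x\<in>X. \<forall>\<omega>\<in>space M. \<forall>\<^sub>F r in sequentially. running_max s N r x \<omega> = t x \<omega>)" for N
    by (rule monotone_limit_exists[OF H, of "running_max s N"])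
       (auto intro: u_in incseq_SucI)
  then obtain v0 where v0: "\<And>N. v0 N \<in> C" "\<And>N. (\<lambda>r. reward H (running_max s N r)) \<longlonglongrightarrow> reward H (v0 N)"
     "\<And>N x \<omega>. x \<in> X \<Longrightarrow> \<omega> \<in> space M \<Longrightarrow> \<forall>\<^sub>F r in sequentially. running_max s N r x \<omega> = v0 N x \<omega>"
    by metis
  \<comment> \<open>The limits are determined on \<open>X\<close> and the sample space only; zero elsewhere makes them decreasing everywhere.\<close>
  define v where "v N x \<omega> = (if x \<in> X \<and> \<omega> \<in> space M then v0 N x \<omega> else 0)" for N x \<omega>
  have v: "v N \<in> C" for N
    by (rule C_limit[where s = "\<lambda>_. v0 N"]) (auto simp: v0 v_def)
  have v_reward: "reward H (v N) = reward H (v0 N)" for N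
    unfolding reward_def by (intro Bochner_Integration.integral_cong sum.cong) (auto simp: v_def)
  have v_dec: "decseq (\<lambda>N. v N x \<omega>)" for x \<omega>
  proof (intro decseq_SucI)
    fix N
    show "v (Suc N) x \<omega> \<le> v N x \<omega>"
    proof (cases "x \<in> X \<and> \<omega> \<in> space M")
      case True
      have "\<forall>\<^sub>F r in sequentially. running_max s N (Suc r) x \<omega> = v0 N x \<omega>"
        using v0(3)[of x \<omega> N] True by (subst eventually_sequentially_Suc) auto
      moreover have "\<forall>\<^sub>F r in sequentially. running_max s (Suc N) r x \<omega> = v0 (Suc N) x \<omega>"
        using v0(3) True by auto
      ultimately have "\<forall>\<^sub>F r in sequentially. v0 (Suc N) x \<omega> \<le> v0 N x \<omega>"
        by eventually_elim (metis running_max_shift)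
      then show ?thesis using True by (simp add: v_def)
    qed (auto simp: v_def)
  qed
  obtain t where t: "t \<in> C" "(\<lambda>N. reward H (v N)) \<longlonglongrightarrow> reward H t"
    by (rule monotone_limit_exists[where s = v, OF H v disjI2[OF v_dec]])
  have below: "V - 2 * (1/2)^N \<le> reward H (v N)" for N
    unfolding v_reward
  proof (rule LIMSEQ_le_const[OF v0(2)], intro exI allI impI)
    fix r :: nat
    have "0 \<le> (1/2::real)^(N + r)" by simp
    then show "V - 2 * (1/2)^N \<le> reward H (running_max s N r)" using u_reward[of N r] by linarith
  qed
  have "(\<lambda>N. (1/2::real)^N) \<longlonglongrightarrow> 0" by (rule LIMSEQ_realpow_zero) auto
  then have "(\<lambda>N. V - 2 * (1/2)^N) \<longlonglongrightarrow> V - 2 * 0"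
    by (intro tendsto_diff tendsto_mult tendsto_const)
  then have "V - 2 * 0 \<le> reward H t"
    by (rule LIMSEQ_le[OF _ t(2)]) (use below in blast)
  then have "reward H \<sigma> \<le> reward H t" if "\<sigma> \<in> C" for \<sigma>
    using le_V[OF that] by linarith
  then show ?thesis using t(1) by blast
qed

definition maximisers :: "('x \<Rightarrow> real \<Rightarrow> 'w \<Rightarrow> real) \<Rightarrow> ('x \<Rightarrow> 'w \<Rightarrow> real) set" where
  "maximisers H = {\<tau> \<in> C. \<forall>\<sigma>\<in>C. reward H \<sigma> \<le> reward H \<tau>}"

text \<open>The two rewards of a maximum and a minimum of maximisers add up to twice the optimal value, so both are optimal.\<close>

lemma maximisers_time_lattice:
  assumes H: "integrable_rewards H"
  shows "time_lattice M X S (maximisers H)"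
proof
  show "maximisers H \<noteq> {}" using maximiser_exists[OF H] by (auto simp: maximisers_def)
next
  fix \<sigma> \<tau> assume *: "\<sigma> \<in> maximisers H" "\<tau> \<in> maximisers H"
  then have C: "\<sigma> \<in> C" "\<tau> \<in> C" by (auto simp: maximisers_def)
  note both = C_max[OF C] C_min[OF C]
  have eq: "reward H (\<lambda>x \<omega>. max (\<sigma> x \<omega>) (\<tau> x \<omega>)) = reward H \<sigma>"
    "reward H (\<lambda>x \<omega>. min (\<sigma> x \<omega>) (\<tau> x \<omega>)) = reward H \<sigma>"
    using reward_modular[OF H C] * both unfolding maximisers_def by fastforce+
  show "(\<lambda>x \<omega>. max (\<sigma> x \<omega>) (\<tau> x \<omega>)) \<in> maximisers H" "(\<lambda>x \<omega>. min (\<sigma> x \<omega>) (\<tau> x \<omega>)) \<in> maximisers H"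
    using both eq *(1) by (auto simp: maximisers_def)
next
  fix s t assume s: "\<And>k. s k \<in> maximisers H"
    and lim: "\<And>x \<omega>. x \<in> X \<Longrightarrow> \<omega> \<in> space M \<Longrightarrow> \<forall>\<^sub>F k in sequentially. s k x \<omega> = t x \<omega>"
  have C: "s k \<in> C" for k using s by (auto simp: maximisers_def)
  have "reward H \<sigma> \<le> reward H t" if "\<sigma> \<in> C" for \<sigma>
    using LIMSEQ_le_const[OF reward_tendsto[OF H C lim], of "reward H \<sigma>"] s that
    by (auto simp: maximisers_def)
  then show "t \<in> maximisers H" using C_limit[OF C lim] by (auto simp: maximisers_def)
qed (auto simp: maximisers_def finite_X finite_S C_values C_measurable)

end

text \<open>Among the maximisers, one with the least expected time is almost surely below any other,
because its minimum with the other one is again a maximiser and has no smaller expectation.\<close>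

lemma (in time_lattice) smallest_maximiser_exists:
  assumes "prob_space M" and H: "integrable_rewards H" and x0: "X = {x0}"
  shows "\<exists>\<tau>\<in>maximisers H. \<forall>\<sigma>\<in>maximisers H. AE \<omega> in M. \<tau> x0 \<omega> \<le> \<sigma> x0 \<omega>"
proof -
  interpret prob_space M by fact
  interpret O: time_lattice M X S "maximisers H" by (rule maximisers_time_lattice[OF H])
  let ?H = "\<lambda>x t \<omega>. - t :: real"
  have H': "O.integrable_rewards ?H" by (auto simp: O.integrable_rewards_def)
  obtain \<tau> where \<tau>: "\<tau> \<in> maximisers H" "\<And>\<sigma>. \<sigma> \<in> maximisers H \<Longrightarrow> O.reward ?H \<sigma> \<le> O.reward ?H \<tau>"
    using O.maximiser_exists[OF H'] by blast
  have int: "integrable M (\<sigma> x0)" if "\<sigma> \<in> maximisers H" for \<sigma>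
    using integrable_minus[OF O.integrable_reward[OF H' that]] by (simp add: x0)
  have "AE \<omega> in M. \<tau> x0 \<omega> \<le> \<sigma> x0 \<omega>" if \<sigma>: "\<sigma> \<in> maximisers H" for \<sigma>
  proof -
    let ?\<rho> = "\<lambda>x \<omega>. min (\<tau> x \<omega>) (\<sigma> x \<omega>)"
    have \<rho>: "?\<rho> \<in> maximisers H" using O.C_min[OF \<tau>(1) \<sigma>] .
    have d: "integrable M (\<lambda>\<omega>. \<tau> x0 \<omega> - ?\<rho> x0 \<omega>)" using int[OF \<tau>(1)] int[OF \<rho>] by auto
    have "(LINT \<omega>|M. \<tau> x0 \<omega> - ?\<rho> x0 \<omega>) \<le> 0"
      using \<tau>(2)[OF \<rho>] int[OF \<tau>(1)] int[OF \<rho>] unfolding O.reward_def unfolding x0 by simp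
    moreover have "(LINT \<omega>|M. \<tau> x0 \<omega> - ?\<rho> x0 \<omega>) \<ge> 0" by (intro integral_nonneg_AE) auto
    ultimately have "AE \<omega> in M. \<tau> x0 \<omega> - ?\<rho> x0 \<omega> = 0"
      using integral_nonneg_eq_0_iff_AE[OF d] by auto
    then show ?thesis by eventually_elim (auto simp: min_def split: if_splits)
  qed
  then show ?thesis using \<tau>(1) by blast
qed


section \<open>The grid\<close>

locale partitioned_space = prob_space M
  for M :: "'w measure" and F :: "real \<Rightarrow> 'w measure" and T :: real
    and m :: nat and p :: "nat \<Rightarrow> real" +
  assumes T_pos: "0 < T" and usual: "usual_filtration M T F" and partition: "partition_of T m p"
begin

lemma p_0 [simp]: "p 0 = 0" and p_m [simp]: "p m = T"
  using partition by (auto simp: partition_of_def)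

lemma p_less: "i < j \<Longrightarrow> j \<le> m \<Longrightarrow> p i < p j"
proof -
  assume ij: "i < j" "j \<le> m"
  then have "p i < p (Suc i)" using partition by (simp add: partition_of_def)
  also have "\<dots> \<le> p j" using partition_of_mono[OF partition, of "Suc i" j] ij by simp
  finally show "p i < p j" .
qed

lemma p_le_iff: "i \<le> m \<Longrightarrow> j \<le> m \<Longrightarrow> p i \<le> p j \<longleftrightarrow> i \<le> j"
  using p_less[of i j] p_less[of j i] by (cases i j rule: linorder_cases) auto

lemma p_less_iff: "i \<le> m \<Longrightarrow> j \<le> m \<Longrightarrow> p i < p j \<longleftrightarrow> i < j"
  using p_le_iff[of j i] by auto

lemma p_eq_iff: "i \<le> m \<Longrightarrow> j \<le> m \<Longrightarrow> p i = p j \<longleftrightarrow> i = j"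
  using p_le_iff[of i j] p_le_iff[of j i] by auto

lemma p_bounds: "j \<le> m \<Longrightarrow> 0 \<le> p j" "j \<le> m \<Longrightarrow> p j \<le> T"
  using p_le_iff[of 0 j] p_le_iff[of j m] by auto

lemma grid_in: "t \<in> p ` {..m} \<Longrightarrow> 0 \<le> t \<and> t \<le> T"
  using p_bounds by auto

lemma right_closed_cell:
  assumes "0 < t" "t \<le> T"
  obtains l where "l < m" "p l < t" "t \<le> p (Suc l)"
proof -
  define k where "k = (LEAST k. t \<le> p k)"
  have k: "t \<le> p k" "k \<le> m" "\<And>l. l < k \<Longrightarrow> p l < t"
    unfolding k_def using assms LeastI[of "\<lambda>k. t \<le> p k" m] Least_le[of "\<lambda>k. t \<le> p k" m]
      not_less_Least[of _ "\<lambda>k. t \<le> p k"] by (auto simp: not_le)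
  have "k \<noteq> 0" using k(1) assms by (metis less_le_not_le p_0)
  then obtain l where "k = Suc l" using not0_implies_Suc by blast
  then show thesis using that[of l] k by auto
qed

lemma left_closed_cell:
  assumes "0 \<le> t" "t < T"
  obtains l where "l < m" "p l \<le> t" "t < p (Suc l)"
proof -
  define k where "k = (LEAST k. t < p k)"
  have k: "t < p k" "k \<le> m" "\<And>l. l < k \<Longrightarrow> p l \<le> t"
    unfolding k_def using assms LeastI[of "\<lambda>k. t < p k" m] Least_le[of "\<lambda>k. t < p k" m]
      not_less_Least[of _ "\<lambda>k. t < p k"] by (auto simp: not_less)
  have "k \<noteq> 0" using k(1) assms by (metis less_le_not_le p_0)
  then obtain l where "k = Suc l" using not0_implies_Suc by blast
  then show thesis using that[of l] k by auto
qed

abbreviation G :: "real \<Rightarrow> 'w measure" where "G \<equiv> grid_filtration F m p"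

lemma G_p: "j \<le> m \<Longrightarrow> G (p j) = F (p j)"
  using grid_filtration_eq[OF partition, of j "p j"] grid_filtration_end[OF partition] p_less[of j "Suc j"]
  by (cases "j = m") auto

lemma G_cases: obtains j where "j \<le> m" "G t = F (p j)"
proof -
  have "Max (insert 0 {j. j \<le> m \<and> p j \<le> t}) \<in> insert 0 {j. j \<le> m \<and> p j \<le> t}"
    by (intro Max_in) auto
  then have "Max (insert 0 {j. j \<le> m \<and> p j \<le> t}) \<le> m" by auto
  then show thesis using that unfolding grid_filtration_def by blast
qed

lemma subalgebra_G: "subalgebra M (G t)"
  using G_cases[of t] usual p_bounds unfolding usual_filtration_def
  by (metis atLeastAtMost_iff)

lemma filtration_G: "filtration (space M) G"
proof
  show "space (G t) = space M" for t using subalgebra_G by (simp add: subalgebra_def)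
  fix s t :: real assume "s \<le> t"
  let ?J = "\<lambda>t. Max (insert 0 {j. j \<le> m \<and> p j \<le> t})"
  have "?J t \<in> insert 0 {j. j \<le> m \<and> p j \<le> t}" for t by (intro Max_in) auto
  then have J: "?J t \<le> m" for t by (metis (no_types, lifting) insert_iff le0 mem_Collect_eq)
  have "?J s \<le> ?J t" using \<open>s \<le> t\<close> by (intro Max_mono) auto
  then have "p (?J s) \<le> p (?J t)" using J by (simp add: p_le_iff)
  then show "sets (G s) \<subseteq> sets (G t)"
    using usual J[of s] J[of t] p_bounds[of "?J s"] p_bounds[of "?J t"]
    unfolding usual_filtration_def grid_filtration_def by auto
qed

sublocale G: filtration "space M" G by (rule filtration_G)

lemma measurable_G_mono:
  assumes "X \<in> borel_measurable (G s)" "s \<le> t"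
  shows "X \<in> borel_measurable (G t)"
  using assms G.sets_F_mono[OF assms(2)] G.space_F by (auto simp: measurable_def subset_iff)

lemma measurable_G_M: "X \<in> borel_measurable (G t) \<Longrightarrow> X \<in> borel_measurable M"
  using measurable_from_subalg[OF subalgebra_G] .


subsection \<open>Grid stopping times\<close>

abbreviation ST :: "('w \<Rightarrow> real) set" where "ST \<equiv> grid_stopping_times M F m p"

lemma ST_value: "\<tau> \<in> ST \<Longrightarrow> \<omega> \<in> space M \<Longrightarrow> \<tau> \<omega> \<in> p ` {..m}"
  by (auto simp: grid_stopping_times_def)

lemma ST_bounds: "\<tau> \<in> ST \<Longrightarrow> \<omega> \<in> space M \<Longrightarrow> 0 \<le> \<tau> \<omega> \<and> \<tau> \<omega> \<le> T"
  using ST_value grid_in by blast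

lemma ST_measurable: "\<tau> \<in> ST \<Longrightarrow> \<tau> \<in> borel_measurable M"
  unfolding grid_stopping_times_def
  using measurable_stopping_time[of G \<tau> M] subalgebra_G by (auto simp: subalgebra_def)

lemma ST_le: "\<tau> \<in> ST \<Longrightarrow> {\<omega>\<in>space M. \<tau> \<omega> \<le> t} \<in> sets (G t)"
  using stopping_timeD[of G \<tau> t] by (simp add: grid_stopping_times_def pred_def G.space_F)

text \<open>Times before \<open>p j\<close> are grid times, so finitely many events from the past are removed.\<close>

lemma ST_eq:
  assumes "\<tau> \<in> ST" "j \<le> m"
  shows "{\<omega>\<in>space M. \<tau> \<omega> = p j} \<in> sets (G (p j))"
proof -
  have "{\<omega>\<in>space M. \<tau> \<omega> = p j}
      = {\<omega>\<in>space M. \<tau> \<omega> \<le> p j} - (\<Union>k<j. {\<omega>\<in>space M. \<tau> \<omega> \<le> p k})"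
    using ST_value[OF assms(1)] assms(2)
    by (fastforce simp: p_le_iff p_eq_iff dest: p_less)
  moreover have "{\<omega>\<in>space M. \<tau> \<omega> \<le> p k} \<in> sets (G (p j))" if "k < j" for k
    using ST_le[OF assms(1), of "p k"] G.sets_F_mono[of "p k" "p j"] p_less[of k j] that assms(2) by auto
  ultimately show ?thesis using ST_le[OF assms(1), of "p j"] by auto
qed

lemma ST_I:
  assumes "\<And>\<omega>. \<omega> \<in> space M \<Longrightarrow> \<tau> \<omega> \<in> p ` {..m}"
    and "\<And>t. {\<omega>\<in>space M. \<tau> \<omega> \<le> t} \<in> sets (G t)"
  shows "\<tau> \<in> ST"
  using assms by (auto simp: grid_stopping_times_def stopping_time_def pred_def G.space_F)

lemma ST_const: "j \<le> m \<Longrightarrow> (\<lambda>_. p j) \<in> ST"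
  by (auto simp: grid_stopping_times_def stopping_time_const)

lemma ST_T: "(\<lambda>_. T) \<in> ST"
  using ST_const[of m] by simp

lemma ST_max: "\<sigma> \<in> ST \<Longrightarrow> \<tau> \<in> ST \<Longrightarrow> (\<lambda>\<omega>. max (\<sigma> \<omega>) (\<tau> \<omega>)) \<in> ST"
  by (auto simp: grid_stopping_times_def max_def intro!: stopping_time_max[unfolded max_def])

lemma ST_min: "\<sigma> \<in> ST \<Longrightarrow> \<tau> \<in> ST \<Longrightarrow> (\<lambda>\<omega>. min (\<sigma> \<omega>) (\<tau> \<omega>)) \<in> ST"
  by (auto simp: grid_stopping_times_def min_def intro!: stopping_time_min[unfolded min_def])

lemma ST_limit:
  assumes s: "\<And>k::nat. s k \<in> ST"
    and lim: "\<And>\<omega>. \<omega> \<in> space M \<Longrightarrow> \<forall>\<^sub>F k in sequentially. s k \<omega> = t \<omega>"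
  shows "t \<in> ST"
proof (rule ST_I)
  fix \<omega> assume \<omega>: "\<omega> \<in> space M"
  obtain k where "s k \<omega> = t \<omega>" using eventually_happens[OF lim[OF \<omega>]] by auto
  then show "t \<omega> \<in> p ` {..m}" using ST_value[OF s \<omega>, of k] by simp
next
  fix r
  have "{\<omega>\<in>space M. t \<omega> \<le> r} = (\<Union>N. \<Inter>k\<in>{N..}. {\<omega>\<in>space M. s k \<omega> \<le> r})"
  proof (intro set_eqI iffI)
    fix \<omega> assume "\<omega> \<in> {\<omega>\<in>space M. t \<omega> \<le> r}"
    then obtain N where "\<And>k. k \<ge> N \<Longrightarrow> s k \<omega> = t \<omega>" "\<omega> \<in> space M" "t \<omega> \<le> r"
      using lim unfolding eventually_sequentially by blast
    then have "\<omega> \<in> (\<Inter>k\<in>{N..}. {\<omega>\<in>space M. s k \<omega> \<le> r})" by auto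
    then show "\<omega> \<in> (\<Union>N. \<Inter>k\<in>{N..}. {\<omega>\<in>space M. s k \<omega> \<le> r})" by blast
  next
    fix \<omega> assume "\<omega> \<in> (\<Union>N. \<Inter>k\<in>{N..}. {\<omega>\<in>space M. s k \<omega> \<le> r})"
    then obtain N where N: "\<And>k. k \<ge> N \<Longrightarrow> \<omega> \<in> space M \<and> s k \<omega> \<le> r" by auto
    then have \<omega>: "\<omega> \<in> space M" by blast
    obtain N' where "\<And>k. k \<ge> N' \<Longrightarrow> s k \<omega> = t \<omega>"
      using lim[OF \<omega>] unfolding eventually_sequentially by blast
    then have "s (max N N') \<omega> = t \<omega>" by simp
    then show "\<omega> \<in> {\<omega>\<in>space M. t \<omega> \<le> r}" using N[of "max N N'"] by auto
  qed
  also have "\<dots> \<in> sets (G r)"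
  proof (rule sets.countable_UN'')
    show "(\<Inter>k\<in>{N..}. {\<omega>\<in>space M. s k \<omega> \<le> r}) \<in> sets (G r)" for N
      by (rule sets.countable_INT') (auto intro: ST_le s)
  qed auto
  finally show "{\<omega>\<in>space M. t \<omega> \<le> r} \<in> sets (G r)" .
qed

lemma integrable_at_ST:
  fixes R :: "real \<Rightarrow> 'w \<Rightarrow> real"
  assumes "\<tau> \<in> ST" "\<And>j. j \<le> m \<Longrightarrow> integrable M (R (p j))"
  shows "integrable M (\<lambda>\<omega>. R (\<tau> \<omega>) \<omega>)"
  by (rule integrable_at_finitely_valued_time(1)[where S = "p ` {..m}" and R = R and \<tau> = \<tau>])
     (use assms ST_measurable ST_value in auto)

text \<open>Optional sampling on a grid: processes with equal integrals over the events of the past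
at each grid time have equal expectations at grid stopping times.\<close>

lemma integral_at_ST_cong:
  fixes Y Z :: "real \<Rightarrow> 'w \<Rightarrow> real"
  assumes \<tau>: "\<tau> \<in> ST" and Y: "\<And>j. j \<le> m \<Longrightarrow> integrable M (Y (p j))"
    and Z: "\<And>j. j \<le> m \<Longrightarrow> integrable M (Z (p j))"
    and eq: "\<And>j A. j \<le> m \<Longrightarrow> A \<in> sets (G (p j)) \<Longrightarrow> (LINT \<omega>:A|M. Y (p j) \<omega>) = (LINT \<omega>:A|M. Z (p j) \<omega>)"
  shows "(LINT \<omega>|M. Y (\<tau> \<omega>) \<omega>) = (LINT \<omega>|M. Z (\<tau> \<omega>) \<omega>)"
proof -
  have "(LINT \<omega>|M. Y (\<tau> \<omega>) \<omega>)
      = (\<Sum>s\<in>p ` {..m}. LINT \<omega>|M. indicator {\<omega>\<in>space M. \<tau> \<omega> = s} \<omega> * Y s \<omega>)"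
    by (rule integrable_at_finitely_valued_time(2)[where S = "p ` {..m}" and R = Y])
       (use \<tau> Y ST_measurable ST_value in auto)
  also have "\<dots> = (\<Sum>s\<in>p ` {..m}. LINT \<omega>|M. indicator {\<omega>\<in>space M. \<tau> \<omega> = s} \<omega> * Z s \<omega>)"
    using eq ST_eq[OF \<tau>] by (intro sum.cong refl) (auto simp: set_lebesgue_integral_def)
  also have "\<dots> = (LINT \<omega>|M. Z (\<tau> \<omega>) \<omega>)"
    by (rule integrable_at_finitely_valued_time(2)[where S = "p ` {..m}" and R = Z, symmetric])
       (use \<tau> Z ST_measurable ST_value in auto)
  finally show ?thesis .
qed


subsection \<open>Integrals against grid measures\<close>

text \<open>Measurability is assumed on \<open>[0,T]\<close> only, where progressive measurability provides it.\<close>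

lemma grid_integral:
  assumes c: "\<And>j. j \<le> m \<Longrightarrow> 0 < c j" and A: "A \<in> sets borel" "A \<subseteq> {0..T}"
    and h: "h \<in> borel_measurable (restrict_space borel {0..T})"
  shows "(LINT t:A|grid_measure m p c. h t) = (\<Sum>j\<le>m. c j * (of_bool (p j \<in> A) * h (p j)))"
proof -
  have "(\<lambda>t. indicator {0..T} t *\<^sub>R h t) \<in> borel_measurable borel"
    using h by (subst (asm) borel_measurable_restrict_space_iff) auto
  then have "(\<lambda>t. indicator A t *\<^sub>R (indicator {0..T} t *\<^sub>R h t)) \<in> borel_measurable borel"
    using A(1) by measurable
  also have "(\<lambda>t. indicator A t *\<^sub>R (indicator {0..T} t *\<^sub>R h t)) = (\<lambda>t. indicator A t *\<^sub>R h t)"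
    using A(2) by (auto simp: indicator_def fun_eq_iff)
  finally have meas: "(\<lambda>t. indicator A t *\<^sub>R h t) \<in> borel_measurable borel" .
  let ?\<nu> = "point_measure {..m} (\<lambda>j. ennreal (c j))"
  have \<nu>: "?\<nu> = density (count_space {..m}) (\<lambda>j. ennreal (c j))" by (simp add: point_measure_def)
  have "(LINT t:A|grid_measure m p c. h t) = (LINT j|?\<nu>. indicator A (p j) *\<^sub>R h (p j))"
    unfolding set_lebesgue_integral_def grid_measure_def
    by (rule integral_distr[OF _ meas]) simp
  also have "\<dots> = (\<Sum>j\<le>m. c j *\<^sub>R (indicator A (p j) *\<^sub>R h (p j)))"
    using c by (intro lebesgue_integral_point_measure_finite) (auto intro: less_imp_le)
  finally show ?thesis by (simp add: indicator_def)
qed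

text \<open>The integral of \<open>h\<close> over \<open>[0,t]\<close> against \<open>grid_measure m p c\<close>, see \<open>integral_accrued\<close>.\<close>

definition accrued :: "(nat \<Rightarrow> real) \<Rightarrow> (real \<Rightarrow> 'w \<Rightarrow> real) \<Rightarrow> real \<Rightarrow> 'w \<Rightarrow> real" where
  "accrued c h t \<omega> = (\<Sum>l\<le>m. c l * (of_bool (p l \<le> t) * h (p l) \<omega>))"

lemma integrable_accrued:
  assumes "\<And>j. j \<le> m \<Longrightarrow> integrable M (h (p j))"
  shows "integrable M (accrued c h t)"
  unfolding accrued_def[abs_def] using assms by (intro Bochner_Integration.integrable_sum) auto

lemma accrued_subtract: "accrued c (\<lambda>t \<omega>. h t \<omega> - k t \<omega>) t \<omega> = accrued c h t \<omega> - accrued c k t \<omega>"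
  unfolding accrued_def sum_subtractf[symmetric] by (intro sum.cong) (auto simp: algebra_simps)

lemma accrued_diff:
  assumes "s \<le> t"
  shows "accrued c h t \<omega> - accrued c h s \<omega> = (\<Sum>l | l \<le> m \<and> s < p l \<and> p l \<le> t. c l * h (p l) \<omega>)"
  unfolding accrued_def sum_subtractf[symmetric] using assms
  by (intro sum.mono_neutral_cong_right) auto

lemma accrued_antimono:
  assumes c: "\<And>j. j \<le> m \<Longrightarrow> 0 < c j" and "s \<le> t"
    and h: "\<And>l. l \<le> m \<Longrightarrow> s < p l \<Longrightarrow> p l \<le> t \<Longrightarrow> h (p l) \<omega> \<le> 0"
  shows "accrued c h t \<omega> \<le> accrued c h s \<omega>"
proof -
  have "accrued c h t \<omega> - accrued c h s \<omega> \<le> 0"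
    unfolding accrued_diff[OF assms(2)] using h c
    by (intro sum_nonpos mult_nonneg_nonpos) (auto intro: less_imp_le)
  then show ?thesis by simp
qed

lemma accrued_strict_mono:
  assumes c: "\<And>j. j \<le> m \<Longrightarrow> 0 < c j" and st: "s < t" "t \<in> p ` {..m}"
    and h: "\<And>l. l \<le> m \<Longrightarrow> s < p l \<Longrightarrow> p l \<le> t \<Longrightarrow> 0 < h (p l) \<omega>"
  shows "accrued c h s \<omega> < accrued c h t \<omega>"
proof -
  obtain k where k: "k \<le> m" "t = p k" using st by auto
  have "0 < accrued c h t \<omega> - accrued c h s \<omega>"
    unfolding accrued_diff[OF less_imp_le[OF st(1)]]
  proof (rule sum_pos2[of _ k])
    show "0 < c k * h (p k) \<omega>" using k st c h by simp
    fix l assume "l \<in> {l. l \<le> m \<and> s < p l \<and> p l \<le> t}"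
    then show "0 \<le> c l * h (p l) \<omega>"
      using c[of l] h[of l] by (intro mult_nonneg_nonneg) (auto intro: less_imp_le)
  qed (use k st in auto)
  then show ?thesis by simp
qed

lemma progressive_section:
  assumes X: "progressively_measurable T F X"
  shows "\<omega> \<in> space M \<Longrightarrow> (\<lambda>t. X t \<omega>) \<in> borel_measurable (restrict_space borel {0..T})"
    and "t \<in> {0..T} \<Longrightarrow> X t \<in> borel_measurable (F t)"
proof -
  have sp: "space (F t) = space M" if "t \<in> {0..T}" for t
    using usual that by (auto simp: usual_filtration_def subalgebra_def)
  have meas: "(\<lambda>(s, \<omega>). X s \<omega>) \<in> borel_measurable (restrict_space borel {0..t} \<Otimes>\<^sub>M F t)"
    if "t \<in> {0..T}" for t
    using X that by (auto simp: progressively_measurable_def)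
  show "(\<lambda>t. X t \<omega>) \<in> borel_measurable (restrict_space borel {0..T})" if "\<omega> \<in> space M"
    using measurable_Pair_compose_split[OF meas[of T], of "\<lambda>t. t" _ "\<lambda>_. \<omega>"] that T_pos sp[of T] by simp
  show "X t \<in> borel_measurable (F t)" if "t \<in> {0..T}"
    using measurable_Pair_compose_split[OF meas[OF that], of "\<lambda>_. t" _ "\<lambda>\<omega>. \<omega>"] that
    by (simp add: space_restrict_space)
qed

lemma integral_accrued:
  assumes c: "\<And>j. j \<le> m \<Longrightarrow> 0 < c j" and h: "progressively_measurable T F h" and \<omega>: "\<omega> \<in> space M"
    and t: "t \<le> T"
  shows "(LINT s:{0..t}|grid_measure m p c. h s \<omega>) = accrued c h t \<omega>"
  using t by (subst grid_integral[OF c _ _ progressive_section(1)[OF h \<omega>]])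
     (auto simp: accrued_def p_bounds intro!: sum.cong)

lemma integral_accrued_diff:
  assumes c: "\<And>j. j \<le> m \<Longrightarrow> 0 < c j" and h: "progressively_measurable T F h" and \<omega>: "\<omega> \<in> space M"
    and t: "0 \<le> r" "r \<le> t" "t \<le> T"
  shows "(LINT s:{r<..t}|grid_measure m p c. h s \<omega>) = accrued c h t \<omega> - accrued c h r \<omega>"
  using t by (subst grid_integral[OF c _ _ progressive_section(1)[OF h \<omega>]])
     (auto simp: accrued_def sum_subtractf[symmetric] intro!: sum.cong)


subsection \<open>Left limits of processes that are constant between grid points\<close>

text \<open>The left limit at \<open>p l\<close> of a process that is constant between grid points, see \<open>left_limit_grid\<close>.\<close>

definition left_value :: "(real \<Rightarrow> 'w \<Rightarrow> real) \<Rightarrow> nat \<Rightarrow> 'w \<Rightarrow> real" where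
  "left_value L l \<omega> = (if l = 0 then 0 else L (p (l - 1)) \<omega>)"

lemma left_limit_cell:
  assumes L: "constant_between M m p L" and \<omega>: "\<omega> \<in> space M" and l: "l < m" "p l < t" "t \<le> p (Suc l)"
  shows "left_limit L t \<omega> = L (p l) \<omega>"
proof -
  have "\<forall>\<^sub>F s in at_left t. s \<in> {p l<..<t}"
    using eventually_at_left_real[OF l(2)] .
  then have "\<forall>\<^sub>F s in at_left t. L s \<omega> = L (p l) \<omega>"
  proof eventually_elim
    case (elim s)
    then have "s \<in> {p l..<p (Suc l)}" using l by auto
    then show ?case using L \<omega> l(1) unfolding constant_between_def by blast
  qed
  then have "((\<lambda>s. L s \<omega>) \<longlongrightarrow> L (p l) \<omega>) (at_left t)" by (rule tendsto_eventually)
  moreover have "0 < t" using l p_bounds[of l] by auto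
  ultimately show ?thesis by (simp add: left_limit_def tendsto_Lim)
qed

lemma left_limit_grid:
  assumes L: "constant_between M m p L" and \<omega>: "\<omega> \<in> space M" and l: "l \<le> m"
  shows "left_limit L (p l) \<omega> = left_value L l \<omega>"
proof (cases l)
  case (Suc k)
  then show ?thesis using left_limit_cell[OF L \<omega>, of k "p l"] l p_less[of k l] by (simp add: left_value_def)
qed (simp add: left_limit_def left_value_def)

lemma left_limit_measurable:
  assumes L: "constant_between M m p L" and \<omega>: "\<omega> \<in> space M"
  shows "(\<lambda>t. left_limit L t \<omega>) \<in> borel_measurable (restrict_space borel {0..T})"
proof -
  have eq: "left_limit L t \<omega> = (\<Sum>l<m. indicator {p l<..p (Suc l)} t * L (p l) \<omega>)" if t: "t \<in> {0..T}" for t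
  proof (cases "t = 0")
    case True
    then show ?thesis using p_bounds(1) by (auto simp: left_limit_def indicator_def leD intro!: sum.neutral)
  next
    case False
    then obtain l where l: "l < m" "p l < t" "t \<le> p (Suc l)"
      using right_closed_cell[of t] t by auto
    have "\<not> (p k < t \<and> t \<le> p (Suc k))" if "k < m" "k \<noteq> l" for k
      using that l p_le_iff[of "Suc k" l] p_le_iff[of "Suc l" k]
      by (cases "k < l") auto
    then have "(\<Sum>l<m. indicator {p l<..p (Suc l)} t * L (p l) \<omega>) = L (p l) \<omega>"
      using l by (subst sum.remove[of _ l]) (auto simp: indicator_def intro!: sum.neutral)
    then show ?thesis using left_limit_cell[OF L \<omega> l] by simp
  qed
  have "(\<lambda>t. \<Sum>l<m. indicator {p l<..p (Suc l)} t * L (p l) \<omega>)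
      \<in> borel_measurable (restrict_space borel {0..T})"
    by (intro measurable_restrict_space1) measurable
  then show ?thesis
    by (subst measurable_cong[OF eq]) (auto simp: space_restrict_space)
qed

end


section \<open>Interpolation\<close>

definition clip :: "nat \<Rightarrow> real \<Rightarrow> real" where
  "clip n l = max 1 (min (real n) l)"

text \<open>On \<open>[1,n]\<close> the interpolation is a combination of hat functions centred at the integers, and outside it
continues with slope one. In this form measurability and integrability
are inherited from the functions \<open>f k\<close>, since the hat functions are bounded and continuous.\<close>

lemma interpolation_hat_functions:
  assumes "1 \<le> n"
  shows "interpolation n f t \<omega> l
    = (\<Sum>k=1..n. max 0 (1 - \<bar>clip n l - real k\<bar>) * f k t \<omega>) + (l - clip n l)"
proof -
  have single: "(\<Sum>k=1..n. max 0 (1 - \<bar>real i - real k\<bar>) * f k t \<omega>) = f i t \<omega>" if "i \<in> {1..n}" for i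
  proof -
    have "(\<Sum>k=1..n. max 0 (1 - \<bar>real i - real k\<bar>) * f k t \<omega>) = (\<Sum>k\<in>{i}. f k t \<omega>)"
      using that by (intro sum.mono_neutral_cong_right) auto
    then show ?thesis by simp
  qed
  consider "l \<le> 1" | "1 < l" "l \<ge> real n" | "1 < l" "l < real n" by linarith
  then show ?thesis
  proof cases
    case 1
    then have "clip n l = real 1" using assms by (auto simp: clip_def)
    then show ?thesis using single[of 1] 1 assms by (simp add: interpolation_def)
  next
    case 2
    then have "clip n l = real n" using assms by (auto simp: clip_def)
    then show ?thesis using single[of n] 2 assms by (simp add: interpolation_def)
  next
    case 3
    then have clip: "clip n l = l" by (auto simp: clip_def)
    define i where "i = nat \<lfloor>l\<rfloor>"
    have i: "real i \<le> l" "l < real i + 1" "1 \<le> i" "i < n"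
      using 3 unfolding i_def by linarith+
    have "(\<Sum>k=1..n. max 0 (1 - \<bar>l - real k\<bar>) * f k t \<omega>)
        = (\<Sum>k\<in>{i, Suc i}. max 0 (1 - \<bar>l - real k\<bar>) * f k t \<omega>)"
    proof (intro sum.mono_neutral_right ballI)
      fix k assume "k \<in> {1..n} - {i, Suc i}"
      then have "k < i \<or> k > Suc i" by auto
      then have "1 - \<bar>l - real k\<bar> \<le> 0"
        using i by (auto simp: abs_if)
      then show "max 0 (1 - \<bar>l - real k\<bar>) * f k t \<omega> = 0" by (simp add: max_def)
    qed (use i in auto)
    also have "\<dots> = (real i + 1 - l) * f i t \<omega> + (l - real i) * f (Suc i) t \<omega>"
      using i by (auto simp: max_def abs_if)
    finally show ?thesis
      using 3 clip by (simp add: interpolation_def Let_def i_def)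
  qed
qed

lemma interpolation_of_nat:
  assumes "k \<in> {1..n}"
  shows "interpolation n f t \<omega> (real k) = f k t \<omega>"
  using assms by (auto simp: interpolation_def Let_def)

text \<open>From \<open>k\<close> on, the interpolation leaves \<open>f k\<close> towards the larger value \<open>f (k + 1)\<close>, or with slope one if \<open>k = n\<close>.\<close>

lemma interpolation_ge_floor:
  assumes k: "k \<in> {1..n}" "real k \<le> l" "l < real k + 1" and "l \<le> real n"
    and f: "k < n \<Longrightarrow> f k t \<omega> \<le> f (Suc k) t \<omega>"
  shows "f k t \<omega> \<le> interpolation n f t \<omega> l"
proof (cases "l = real k")
  case True
  then show ?thesis using interpolation_of_nat[OF k(1), of f t \<omega>] by simp
next
  case False
  then have l: "real k < l" "l < real k + 1" "k < n" using k(2,3) assms(4) by auto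
  have fl: "nat \<lfloor>l\<rfloor> = k" using l by linarith
  show ?thesis
  proof (cases "l \<ge> real n")
    case True
    then show ?thesis using l assms by auto
  next
    case False
    then have "interpolation n f t \<omega> l = (real k + 1 - l) * f k t \<omega> + (l - real k) * f (Suc k) t \<omega>"
      using l k by (auto simp: interpolation_def Let_def fl)
    also have "\<dots> = f k t \<omega> + (l - real k) * (f (Suc k) t \<omega> - f k t \<omega>)" by (simp add: algebra_simps)
    finally show ?thesis using f[OF l(3)] l by simp
  qed
qed


section \<open>Counting the agents who have stopped\<close>

definition stopped_before :: "nat \<Rightarrow> (nat \<Rightarrow> 'w \<Rightarrow> real) \<Rightarrow> real \<Rightarrow> 'w \<Rightarrow> nat" where
  "stopped_before n \<tau> s \<omega> = card {i \<in> {1..n}. \<tau> i \<omega> < s}"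

lemma card_initial_segment:
  assumes P: "\<And>i j. 1 \<le> i \<Longrightarrow> i \<le> j \<Longrightarrow> j \<le> n \<Longrightarrow> P j \<Longrightarrow> P i" and i: "i \<in> {1..n}"
  shows "i \<le> card {i \<in> {1..n}. P i} \<longleftrightarrow> P i"
proof
  assume "P i"
  then have "{1..i} \<subseteq> {i \<in> {1..n}. P i}" using P[of _ i] i by auto
  from card_mono[OF _ this] show "i \<le> card {i \<in> {1..n}. P i}" by simp
next
  assume *: "i \<le> card {i \<in> {1..n}. P i}"
  show "P i"
  proof (rule ccontr)
    assume "\<not> P i"
    then have "{i \<in> {1..n}. P i} \<subseteq> {1..<i}"
      using P[of i] i by (auto simp: not_le[symmetric])
    from card_mono[OF _ this] show False using * i by auto
  qed
qed

lemma stopped_before_le: "stopped_before n \<tau> s \<omega> \<le> n"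
proof -
  have "card {i \<in> {1..n}. \<tau> i \<omega> < s} \<le> card {1..n}" by (intro card_mono) auto
  then show ?thesis by (simp add: stopped_before_def)
qed


section \<open>Payoffs as expectations of finite sums\<close>

text \<open>Summation by parts. The second argument of \<open>a\<close> stands for a time: on the right, the \<open>i\<close>-th summand
refers to the \<open>i\<close>-th time only.\<close>

lemma nested_differences:
  fixes a :: "nat \<Rightarrow> nat \<Rightarrow> real"
  shows "(\<Sum>i=1..n. \<Sum>j=i..n. a j (Suc j) - a j j)
    = (\<Sum>i=1..n. real (i - 1) * a (i - 1) i - real i * a i i) + real n * a n (Suc n)"
proof (induction n)
  case (Suc n)
  define d where "d j = a j (Suc j) - a j j" for j
  have "(\<Sum>i=1..Suc n. \<Sum>j=i..Suc n. d j) = (\<Sum>i=1..Suc n. (\<Sum>j=i..n. d j) + d (Suc n))"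
    by (intro sum.cong) auto
  also have "\<dots> = (\<Sum>i=1..n. \<Sum>j=i..n. d j) + real (Suc n) * d (Suc n)"
    by (simp add: sum.distrib)
  finally show ?case using Suc unfolding d_def by (simp add: algebra_simps)
qed simp

locale contract_problem = partitioned_space M F T m p
  for M :: "'w measure" and F T m p +
  fixes f g :: "nat \<Rightarrow> real \<Rightarrow> 'w \<Rightarrow> real" and \<xi> :: "'w \<Rightarrow> real" and n :: nat and cA cP :: "nat \<Rightarrow> real"
  assumes n_pos: "1 \<le> n"
    and f_prog: "\<And>i. i \<in> {1..n} \<Longrightarrow> progressively_measurable T F (f i)"
    and g_prog: "\<And>i. i \<in> {1..n} \<Longrightarrow> progressively_measurable T F (g i)"
    and \<xi>_measurable: "\<xi> \<in> borel_measurable (F T)" and \<xi>_integrable: "integrable M \<xi>"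
    and cA_pos: "\<And>j. j \<le> m \<Longrightarrow> 0 < cA j" and cP_pos: "\<And>j. j \<le> m \<Longrightarrow> 0 < cP j"
    and f_integrable: "\<And>i j. i \<in> {1..n} \<Longrightarrow> j \<le> m \<Longrightarrow> integrable M (f i (p j))"
    and g_integrable: "\<And>i j. i \<in> {1..n} \<Longrightarrow> j \<le> m \<Longrightarrow> integrable M (g i (p j))"
    and f_increasing: "\<And>i j \<omega>. i \<in> {1..<n} \<Longrightarrow> j \<le> m \<Longrightarrow> \<omega> \<in> space M \<Longrightarrow> f i (p j) \<omega> < f (Suc i) (p j) \<omega>"
begin

abbreviation \<mu>A :: "real measure" where "\<mu>A \<equiv> grid_measure m p cA"
abbreviation \<mu>P :: "real measure" where "\<mu>P \<equiv> grid_measure m p cP"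
abbreviation OT :: "(nat \<Rightarrow> 'w \<Rightarrow> real) set" where "OT \<equiv> ordered_stopping_times M T F m p n"

lemma f_less:
  assumes "i \<in> {1..n}" "j \<in> {1..n}" "i < j" "l \<le> m" "\<omega> \<in> space M"
  shows "f i (p l) \<omega> < f j (p l) \<omega>"
proof -
  have "Suc i \<le> j" using assms by simp
  then show ?thesis using assms(2)
  proof (induction j rule: dec_induct)
    case base
    then show ?case using f_increasing[of i l \<omega>] assms by auto
  next
    case (step k)
    then have "f i (p l) \<omega> < f k (p l) \<omega>" "f k (p l) \<omega> < f (Suc k) (p l) \<omega>"
      using f_increasing[of k l \<omega>] assms by auto
    then show ?case by simp
  qed
qed

lemma OT_ST: "\<tau> \<in> OT \<Longrightarrow> i \<in> {1..Suc n} \<Longrightarrow> \<tau> i \<in> ST"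
  using ST_T by (cases "i = Suc n") (auto simp: ordered_stopping_times_def)

lemma OT_mono:
  assumes "\<tau> \<in> OT" "\<omega> \<in> space M" "1 \<le> i" "i \<le> j" "j \<le> Suc n"
  shows "\<tau> i \<omega> \<le> \<tau> j \<omega>"
  using assms(4,5)
proof (induction j rule: dec_induct)
  case (step k)
  have "\<tau> k \<omega> \<le> \<tau> (Suc k) \<omega>"
  proof (cases "k = n")
    case True
    then have "\<tau> (Suc k) \<omega> = T" using assms(1) by (simp add: ordered_stopping_times_def)
    then show ?thesis using ST_bounds[OF OT_ST[OF assms(1), of k] assms(2)] step assms(3) by auto
  next
    case False
    then show ?thesis using assms step by (auto simp: ordered_stopping_times_def)
  qed
  then show ?case using step by auto
qed simp

text \<open>The times are ordered, so the agents who stop before \<open>s\<close> form an initial segment of \<open>{1..n}\<close>.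
This is the Galois connection between families of times and their counting process.\<close>

lemma le_stopped_before:
  assumes "\<tau> \<in> OT" "\<omega> \<in> space M" "i \<in> {1..n}"
  shows "i \<le> stopped_before n \<tau> s \<omega> \<longleftrightarrow> \<tau> i \<omega> < s"
  unfolding stopped_before_def
proof (rule card_initial_segment[OF _ assms(3)])
  fix i j assume "1 \<le> i" "i \<le> j" "j \<le> n" "\<tau> j \<omega> < s"
  then show "\<tau> i \<omega> < s" using OT_mono[OF assms(1,2), of i j] by auto
qed

definition agent_gain :: "nat \<Rightarrow> (real \<Rightarrow> 'w \<Rightarrow> real) \<Rightarrow> real \<Rightarrow> 'w \<Rightarrow> real" where
  "agent_gain i Y t \<omega> = accrued cA (f i) t \<omega> + Y t \<omega>"

lemma agent_payoff_eq:
  assumes i: "i \<in> {1..n}" and \<tau>: "\<tau> \<in> ST"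
  shows "agent_payoff M \<mu>A (f i) Y \<tau> = (LINT \<omega>|M. agent_gain i Y (\<tau> \<omega>) \<omega>)"
  unfolding agent_payoff_def agent_gain_def
  by (intro Bochner_Integration.integral_cong refl)
     (simp add: integral_accrued[OF cA_pos f_prog[OF i]] ST_bounds[OF \<tau>])

definition stopping_gain :: "(nat \<Rightarrow> 'w \<Rightarrow> real) \<Rightarrow> 'w \<Rightarrow> real" where
  "stopping_gain \<tau> \<omega> = (\<Sum>i=1..n. accrued cP (g i) (\<tau> i \<omega>) \<omega>
     - (\<Sum>j=i..n. accrued cA (f j) (\<tau> (Suc j) \<omega>) \<omega> - accrued cA (f j) (\<tau> j \<omega>) \<omega>) - \<xi> \<omega>)"

lemma stopping_payoff_eq:
  assumes \<tau>: "\<tau> \<in> OT"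
  shows "stopping_payoff M \<mu>A \<mu>P n f g \<xi> \<tau> = (LINT \<omega>|M. stopping_gain \<tau> \<omega>)"
  unfolding stopping_payoff_def stopping_gain_def
proof (intro Bochner_Integration.integral_cong refl sum.cong arg_cong2[where f = "(-)"])
  fix \<omega> i assume \<omega>: "\<omega> \<in> space M" and i: "i \<in> {1..n}"
  show "(LINT t:{0..\<tau> i \<omega>}|\<mu>P. g i t \<omega>) = accrued cP (g i) (\<tau> i \<omega>) \<omega>"
    using integral_accrued[OF cP_pos g_prog[OF i] \<omega>] ST_bounds[OF OT_ST[OF \<tau>, of i] \<omega>] i by auto
  fix j assume j: "j \<in> {i..n}"
  show "(LINT t:{\<tau> j \<omega><..\<tau> (Suc j) \<omega>}|\<mu>A. f j t \<omega>)
      = accrued cA (f j) (\<tau> (Suc j) \<omega>) \<omega> - accrued cA (f j) (\<tau> j \<omega>) \<omega>"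
    using i j \<omega> ST_bounds[OF OT_ST[OF \<tau>, of j] \<omega>] ST_bounds[OF OT_ST[OF \<tau>, of "Suc j"] \<omega>]
      OT_mono[OF \<tau> \<omega>, of j "Suc j"]
    by (intro integral_accrued_diff[OF cA_pos f_prog]) auto
qed

lemma integrable_stopping_gain:
  assumes \<tau>: "\<tau> \<in> OT"
  shows "integrable M (stopping_gain \<tau>)"
proof -
  have "integrable M (\<lambda>\<omega>. accrued cP (g i) (\<tau> i \<omega>) \<omega>)" if "i \<in> {1..n}" for i
    by (rule integrable_at_ST) (use OT_ST[OF \<tau>] integrable_accrued g_integrable that in auto)
  moreover have "integrable M (\<lambda>\<omega>. accrued cA (f j) (\<tau> k \<omega>) \<omega>)" if "j \<in> {1..n}" "k \<in> {1..Suc n}" for j k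
    by (rule integrable_at_ST) (use OT_ST[OF \<tau>] integrable_accrued f_integrable that in auto)
  ultimately show ?thesis
    unfolding stopping_gain_def[abs_def]
    by (intro Bochner_Integration.integrable_sum Bochner_Integration.integrable_diff \<xi>_integrable) auto
qed

text \<open>The rate at which the implementing contract makes the waiting agents lose promised payments: the running
payoff of the last agent who stopped before \<open>t\<close>, and \<open>f 1 t \<omega> - 1\<close> if there is none.\<close>

definition pay_rate :: "(nat \<Rightarrow> 'w \<Rightarrow> real) \<Rightarrow> real \<Rightarrow> 'w \<Rightarrow> real" where
  "pay_rate \<tau> t \<omega> = interpolation n f t \<omega> (real (stopped_before n \<tau> t \<omega>))"

lemma pay_rate_eq:
  assumes "stopped_before n \<tau> t \<omega> \<ge> 1"
  shows "pay_rate \<tau> t \<omega> = f (stopped_before n \<tau> t \<omega>) t \<omega>"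
  using assms stopped_before_le[of n \<tau> t \<omega>] by (simp add: pay_rate_def interpolation_of_nat)

text \<open>The intervals \<open>(\<tau> j, \<tau> (j + 1)]\<close> with \<open>j \<ge> i\<close> partition \<open>(\<tau> i, T]\<close>, and on the \<open>j\<close>-th of them exactly
\<open>j\<close> agents have stopped before.\<close>

lemma pay_rate_sum:
  assumes \<tau>: "\<tau> \<in> OT" and \<omega>: "\<omega> \<in> space M" and i: "i \<in> {1..n}"
  shows "(\<Sum>j=i..n. accrued cA (f j) (\<tau> (Suc j) \<omega>) \<omega> - accrued cA (f j) (\<tau> j \<omega>) \<omega>)
       = (\<Sum>l\<le>m. cA l * (of_bool (\<tau> i \<omega> < p l) * pay_rate \<tau> (p l) \<omega>))"
proof -
  have "(\<Sum>j=i..n. accrued cA (f j) (\<tau> (Suc j) \<omega>) \<omega> - accrued cA (f j) (\<tau> j \<omega>) \<omega>)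
      = (\<Sum>j=i..n. \<Sum>l\<le>m. cA l * ((of_bool (p l \<le> \<tau> (Suc j) \<omega>) - of_bool (p l \<le> \<tau> j \<omega>)) * f j (p l) \<omega>))"
    unfolding accrued_def sum_subtractf[symmetric] by (intro sum.cong) (auto simp: algebra_simps)
  also have "\<dots> = (\<Sum>l\<le>m. \<Sum>j=i..n. cA l * ((of_bool (p l \<le> \<tau> (Suc j) \<omega>) - of_bool (p l \<le> \<tau> j \<omega>)) * f j (p l) \<omega>))"
    by (rule sum.swap)
  also have "\<dots> = (\<Sum>l\<le>m. cA l * (of_bool (\<tau> i \<omega> < p l) * pay_rate \<tau> (p l) \<omega>))"
  proof (rule sum.cong[OF refl])
    fix l assume l: "l \<in> {..m}"
    let ?N = "stopped_before n \<tau> (p l) \<omega>"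
    \<comment> \<open>The grid point \<open>p l\<close> lies in the interval whose index is the number of agents who stopped before.\<close>
    have "of_bool (p l \<le> \<tau> (Suc j) \<omega>) - of_bool (p l \<le> \<tau> j \<omega>) = (of_bool (j = ?N) :: real)"
      if j: "j \<in> {i..n}" for j
    proof -
      have "j \<le> ?N \<longleftrightarrow> \<tau> j \<omega> < p l" using le_stopped_before[OF \<tau> \<omega>, of j "p l"] i j by auto
      moreover have "?N \<le> j \<longleftrightarrow> p l \<le> \<tau> (Suc j) \<omega>"
      proof (cases "j = n")
        case True
        then have "\<tau> (Suc j) \<omega> = T" using \<tau> by (simp add: ordered_stopping_times_def)
        then show ?thesis using p_bounds l True stopped_before_le[of n \<tau> "p l" \<omega>] by auto
      next
        case False
        then show ?thesis using le_stopped_before[OF \<tau> \<omega>, of "Suc j" "p l"] i j by auto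
      qed
      moreover have "\<tau> j \<omega> \<le> \<tau> (Suc j) \<omega>" using OT_mono[OF \<tau> \<omega>, of j "Suc j"] i j by auto
      ultimately show ?thesis by auto
    qed
    then have "(\<Sum>j=i..n. cA l * ((of_bool (p l \<le> \<tau> (Suc j) \<omega>) - of_bool (p l \<le> \<tau> j \<omega>)) * f j (p l) \<omega>))
        = (\<Sum>j=i..n. cA l * (of_bool (j = ?N) * f j (p l) \<omega>))"
      by (intro sum.cong) auto
    also have "\<dots> = (\<Sum>j=i..n. if j = ?N then cA l * f j (p l) \<omega> else 0)"
      by (intro sum.cong) auto
    also have "\<dots> = of_bool (i \<le> ?N) * (cA l * f ?N (p l) \<omega>)"
      using stopped_before_le[of n \<tau> "p l" \<omega>] by (simp add: sum.delta)
    also have "\<dots> = cA l * (of_bool (\<tau> i \<omega> < p l) * pay_rate \<tau> (p l) \<omega>)"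
      using pay_rate_eq[of \<tau> "p l" \<omega>] le_stopped_before[OF \<tau> \<omega> i, of "p l"] i by auto
    finally show "(\<Sum>j=i..n. cA l * ((of_bool (p l \<le> \<tau> (Suc j) \<omega>) - of_bool (p l \<le> \<tau> j \<omega>)) * f j (p l) \<omega>))
        = cA l * (of_bool (\<tau> i \<omega> < p l) * pay_rate \<tau> (p l) \<omega>)" .
  qed
  finally show ?thesis .
qed


section \<open>Controls and ordered stopping times\<close>

definition control_gain :: "(real \<Rightarrow> 'w \<Rightarrow> real) \<Rightarrow> 'w \<Rightarrow> real" where
  "control_gain L \<omega> = (\<Sum>i=1..n.
     (\<Sum>l\<le>m. cP l * (g i (p l) \<omega> * of_bool (left_value L l \<omega> < real i)))
     - (\<Sum>l\<le>m. cA l * (interpolation n f (p l) \<omega> (left_value L l \<omega>) * of_bool (left_value L l \<omega> \<ge> real i)))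
     - \<xi> \<omega>)"

lemma interpolation_measurable:
  assumes "\<And>k. k \<in> {1..n} \<Longrightarrow> (\<lambda>x. f k (t x) (w x)) \<in> borel_measurable N" "l \<in> borel_measurable N"
  shows "(\<lambda>x. interpolation n f (t x) (w x) (l x)) \<in> borel_measurable N"
proof -
  have c: "(\<lambda>x. clip n (l x)) \<in> borel_measurable N" unfolding clip_def using assms(2) by measurable
  show ?thesis
    unfolding interpolation_hat_functions[OF n_pos]
    by (intro borel_measurable_add borel_measurable_sum borel_measurable_times borel_measurable_diff
        borel_measurable_max borel_measurable_const borel_measurable_abs assms c)
qed

lemma control_payoff_eq:
  assumes L: "L \<in> controls M T F m p n"
  shows "control_payoff M T \<mu>A \<mu>P n f g \<xi> L = (LINT \<omega>|M. control_gain L \<omega>)"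
  unfolding control_payoff_def control_gain_def
proof (intro Bochner_Integration.integral_cong refl sum.cong arg_cong2[where f = "(-)"])
  fix \<omega> i assume \<omega>: "\<omega> \<in> space M" and i: "i \<in> {1..n}"
  have cb: "constant_between M m p L" using L by (simp add: controls_def)
  note ll = left_limit_measurable[OF cb \<omega>]
  have of_bool_measurable: "(\<lambda>t. of_bool (P t) :: real) \<in> borel_measurable N"
    if "Measurable.pred N P" for P and N :: "real measure"
    using that unfolding of_bool_def by measurable
  have meas: "(\<lambda>t. g i t \<omega> * of_bool (left_limit L t \<omega> < real i)) \<in> borel_measurable (restrict_space borel {0..T})"
    by (intro borel_measurable_times of_bool_measurable progressive_section(1)[OF g_prog[OF i] \<omega>]
        borel_measurable_pred_less ll borel_measurable_const)
  show "(LINT t:{0..T}|\<mu>P. g i t \<omega> * of_bool (left_limit L t \<omega> < real i))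
      = (\<Sum>l\<le>m. cP l * (g i (p l) \<omega> * of_bool (left_value L l \<omega> < real i)))"
    by (subst grid_integral[OF cP_pos _ _ meas])
       (auto simp: p_bounds left_limit_grid[OF cb \<omega>] intro!: sum.cong)
  have meas: "(\<lambda>t. interpolation n f t \<omega> (left_limit L t \<omega>) * of_bool (left_limit L t \<omega> \<ge> real i))
      \<in> borel_measurable (restrict_space borel {0..T})"
    by (intro borel_measurable_times of_bool_measurable interpolation_measurable
        progressive_section(1)[OF f_prog \<omega>] pred_le_const ll) (use ll in auto)
  show "(LINT t:{0..T}|\<mu>A. interpolation n f t \<omega> (left_limit L t \<omega>) * of_bool (left_limit L t \<omega> \<ge> real i))
      = (\<Sum>l\<le>m. cA l * (interpolation n f (p l) \<omega> (left_value L l \<omega>) * of_bool (left_value L l \<omega> \<ge> real i)))"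
    by (subst grid_integral[OF cA_pos _ _ meas])
       (auto simp: p_bounds left_limit_grid[OF cb \<omega>] intro!: sum.cong)
qed


lemma OT_grid_index:
  assumes "\<tau> \<in> OT" "\<omega> \<in> space M" "i \<in> {1..Suc n}"
  obtains j where "j \<le> m" "\<tau> i \<omega> = p j"
  using ST_value[OF OT_ST[OF assms(1,3)] assms(2)] by auto

lemma control_gain_eq:
  assumes \<tau>: "\<tau> \<in> OT" and \<omega>: "\<omega> \<in> space M"
    and L: "\<And>l. l \<le> m \<Longrightarrow> left_value L l \<omega> = real (stopped_before n \<tau> (p l) \<omega>)"
  shows "control_gain L \<omega> = stopping_gain \<tau> \<omega>"
  unfolding control_gain_def stopping_gain_def
proof (rule sum.cong[OF refl])
  fix i assume i: "i \<in> {1..n}"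
  note iff = le_stopped_before[OF \<tau> \<omega> i]
  have "(\<Sum>l\<le>m. cP l * (g i (p l) \<omega> * of_bool (left_value L l \<omega> < real i))) = accrued cP (g i) (\<tau> i \<omega>) \<omega>"
    unfolding accrued_def
  proof (intro sum.cong refl)
    fix l assume "l \<in> {..m}"
    then have "left_value L l \<omega> < real i \<longleftrightarrow> p l \<le> \<tau> i \<omega>" using iff[of "p l"] L[of l] by auto
    then show "cP l * (g i (p l) \<omega> * of_bool (left_value L l \<omega> < real i)) = cP l * (of_bool (p l \<le> \<tau> i \<omega>) * g i (p l) \<omega>)"
      by simp
  qed
  moreover have "(\<Sum>l\<le>m. cA l * (interpolation n f (p l) \<omega> (left_value L l \<omega>) * of_bool (real i \<le> left_value L l \<omega>)))
    = (\<Sum>j=i..n. accrued cA (f j) (\<tau> (Suc j) \<omega>) \<omega> - accrued cA (f j) (\<tau> j \<omega>) \<omega>)"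
    unfolding pay_rate_sum[OF \<tau> \<omega> i]
  proof (intro sum.cong refl)
    fix l assume "l \<in> {..m}"
    then show "cA l * (interpolation n f (p l) \<omega> (left_value L l \<omega>) * of_bool (real i \<le> left_value L l \<omega>))
        = cA l * (of_bool (\<tau> i \<omega> < p l) * pay_rate \<tau> (p l) \<omega>)"
      using iff[of "p l"] L[of l] by (simp add: pay_rate_def)
  qed
  ultimately show "(\<Sum>l\<le>m. cP l * (g i (p l) \<omega> * of_bool (left_value L l \<omega> < real i)))
     - (\<Sum>l\<le>m. cA l * (interpolation n f (p l) \<omega> (left_value L l \<omega>) * of_bool (real i \<le> left_value L l \<omega>))) - \<xi> \<omega>
     = accrued cP (g i) (\<tau> i \<omega>) \<omega>
     - (\<Sum>j=i..n. accrued cA (f j) (\<tau> (Suc j) \<omega>) \<omega> - accrued cA (f j) (\<tau> j \<omega>) \<omega>) - \<xi> \<omega>"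
    by (simp only:)
qed

text \<open>The times see only the integer part of \<open>L\<close>. The gain terms compare \<open>L\<close> with integers and are
unchanged, while the cost terms do not increase by \<open>interpolation_ge_floor\<close>.\<close>

lemma control_gain_le:
  assumes \<tau>: "\<tau> \<in> OT" and \<omega>: "\<omega> \<in> space M"
    and range: "\<And>l. l \<le> m \<Longrightarrow> left_value L l \<omega> \<in> {0..real n}"
    and iff: "\<And>i l. i \<in> {1..n} \<Longrightarrow> l \<le> m \<Longrightarrow> \<tau> i \<omega> < p l \<longleftrightarrow> real i \<le> left_value L l \<omega>"
  shows "control_gain L \<omega> \<le> stopping_gain \<tau> \<omega>"
  unfolding control_gain_def stopping_gain_def
proof (intro sum_mono diff_mono order_refl)
  fix i assume i: "i \<in> {1..n}"
  show "(\<Sum>l\<le>m. cP l * (g i (p l) \<omega> * of_bool (left_value L l \<omega> < real i))) \<le> accrued cP (g i) (\<tau> i \<omega>) \<omega>"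
    unfolding accrued_def
  proof (intro eq_refl sum.cong refl)
    fix l assume "l \<in> {..m}"
    then have "left_value L l \<omega> < real i \<longleftrightarrow> p l \<le> \<tau> i \<omega>" using iff[OF i, of l] by auto
    then show "cP l * (g i (p l) \<omega> * of_bool (left_value L l \<omega> < real i)) = cP l * (of_bool (p l \<le> \<tau> i \<omega>) * g i (p l) \<omega>)"
      by simp
  qed
  show "(\<Sum>j=i..n. accrued cA (f j) (\<tau> (Suc j) \<omega>) \<omega> - accrued cA (f j) (\<tau> j \<omega>) \<omega>)
    \<le> (\<Sum>l\<le>m. cA l * (interpolation n f (p l) \<omega> (left_value L l \<omega>) * of_bool (real i \<le> left_value L l \<omega>)))"
    unfolding pay_rate_sum[OF \<tau> \<omega> i]
  proof (intro sum_mono)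
    fix l assume l: "l \<in> {..m}"
    let ?N = "stopped_before n \<tau> (p l) \<omega>" and ?L = "left_value L l \<omega>"
    have "pay_rate \<tau> (p l) \<omega> \<le> interpolation n f (p l) \<omega> ?L" if "\<tau> i \<omega> < p l"
    proof -
      have N1: "1 \<le> ?N" using le_stopped_before[OF \<tau> \<omega> i, of "p l"] that i by auto
      have N: "?N \<in> {1..n}" using N1 stopped_before_le[of n \<tau> "p l" \<omega>] by auto
      have le: "real ?N \<le> ?L"
        using iff[OF N, of l] le_stopped_before[OF \<tau> \<omega> N, of "p l"] l by auto
      have less: "?L < real ?N + 1"
      proof (cases "?N = n")
        case True
        then show ?thesis using range[of l] l by auto
      next
        case False
        then have S: "Suc ?N \<in> {1..n}" using N by auto
        have "\<not> \<tau> (Suc ?N) \<omega> < p l" using le_stopped_before[OF \<tau> \<omega> S, of "p l"] by simp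
        then show ?thesis using iff[OF S, of l] l by simp
      qed
      have "f ?N (p l) \<omega> \<le> interpolation n f (p l) \<omega> ?L"
      proof (rule interpolation_ge_floor[OF N le less])
        show "?L \<le> real n" using range[of l] l by auto
        show "f ?N (p l) \<omega> \<le> f (Suc ?N) (p l) \<omega>" if "?N < n"
          using f_increasing[of ?N l \<omega>] N that l \<omega> by auto
      qed
      then show ?thesis using pay_rate_eq[OF N1] by simp
    qed
    then show "cA l * (of_bool (\<tau> i \<omega> < p l) * pay_rate \<tau> (p l) \<omega>)
        \<le> cA l * (interpolation n f (p l) \<omega> ?L * of_bool (real i \<le> ?L))"
      using iff[OF i, of l] cA_pos[of l] l by (intro mult_left_mono) auto
  qed
qed

text \<open>Agents who stop at \<open>t\<close> itself are counted, which makes the left limits count those who stopped before.\<close>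

definition counting_control :: "(nat \<Rightarrow> 'w \<Rightarrow> real) \<Rightarrow> real \<Rightarrow> 'w \<Rightarrow> real" where
  "counting_control \<tau> t \<omega> = (\<Sum>i=1..n. of_bool (\<tau> i \<omega> \<le> t))"

lemma counting_control_left_value:
  assumes \<tau>: "\<tau> \<in> OT" and \<omega>: "\<omega> \<in> space M" and l: "l \<le> m"
  shows "left_value (counting_control \<tau>) l \<omega> = real (stopped_before n \<tau> (p l) \<omega>)"
proof (cases l)
  case 0
  have "\<not> \<tau> i \<omega> < 0" if "i \<in> {1..n}" for i
    using ST_bounds[OF OT_ST[OF \<tau>, of i] \<omega>] that by auto
  then have "{i \<in> {1..n}. \<tau> i \<omega> < p l} = {}" using 0 by auto
  then show ?thesis using 0 by (simp add: stopped_before_def left_value_def)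
next
  case (Suc k)
  have "\<tau> i \<omega> \<le> p k \<longleftrightarrow> \<tau> i \<omega> < p l" if i: "i \<in> {1..n}" for i
  proof -
    obtain j where "j \<le> m" "\<tau> i \<omega> = p j" by (rule OT_grid_index[OF \<tau> \<omega>, of i]) (use i in auto)
    then show ?thesis using Suc l by (simp add: p_le_iff p_less_iff less_Suc_eq_le)
  qed
  then have "{i \<in> {1..n}. \<tau> i \<omega> < p l} = {i \<in> {1..n}. \<tau> i \<omega> \<le> p k}" by auto
  then show ?thesis using Suc
    by (simp add: left_value_def counting_control_def stopped_before_def sum.If_cases of_bool_def Int_def)
qed

lemma counting_control_integer: "counting_control \<tau> t \<omega> \<in> real ` {0..n}"
proof -
  have "counting_control \<tau> t \<omega> = real (card {i \<in> {1..n}. \<tau> i \<omega> \<le> t})"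
    by (simp add: counting_control_def sum.If_cases of_bool_def Int_def)
  moreover have "card {i \<in> {1..n}. \<tau> i \<omega> \<le> t} \<le> card {1..n}" by (intro card_mono) auto
  ultimately show ?thesis by auto
qed

text \<open>Paths that are constant on the half-open cells of the grid are cadlag, so an adapted process of this kind is among
the generators of the optional sigma-algebra.\<close>

lemma optional_of_constant_between:
  assumes ad: "adapted T G X" and cb: "constant_between M m p X"
  shows "optional_process M T G X"
proof -
  have cadlag: "cadlag_paths M T X"
    unfolding cadlag_paths_def
  proof (intro ballI conjI)
    fix \<omega> t assume \<omega>: "\<omega> \<in> space M" and t: "t \<in> {0..<T}"
    obtain l where l: "l < m" "p l \<le> t" "t < p (Suc l)" using left_closed_cell[of t] t by auto
    have X: "X s \<omega> = X t \<omega>" if "s \<in> {t<..<p (Suc l)}" for s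
    proof -
      have "s \<in> {p l..<p (Suc l)}" "t \<in> {p l..<p (Suc l)}" using l that by auto
      then show ?thesis using cb \<omega> l(1) unfolding constant_between_def by metis
    qed
    have "\<forall>\<^sub>F s in at_right t. X s \<omega> = X t \<omega>"
      using eventually_at_right_real[OF l(3)] by eventually_elim (rule X)
    then show "((\<lambda>s. X s \<omega>) \<longlongrightarrow> X t \<omega>) (at_right t)" by (rule tendsto_eventually)
  next
    fix \<omega> t assume \<omega>: "\<omega> \<in> space M" and t: "t \<in> {0<..T}"
    obtain l where l: "l < m" "p l < t" "t \<le> p (Suc l)" using right_closed_cell[of t] t by auto
    have X: "X s \<omega> = X (p l) \<omega>" if "s \<in> {p l<..<t}" for s
    proof -
      have "s \<in> {p l..<p (Suc l)}" using l that by auto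
      then show ?thesis using cb \<omega> l(1) unfolding constant_between_def by blast
    qed
    have "\<forall>\<^sub>F s in at_left t. X s \<omega> = X (p l) \<omega>"
      using eventually_at_left_real[OF l(2)] by eventually_elim (rule X)
    then show "\<exists>l. ((\<lambda>s. X s \<omega>) \<longlongrightarrow> l) (at_left t)" by (intro exI tendsto_eventually)
  qed
  let ?E = "{{(t, \<omega>) \<in> {0..T} \<times> space M. X t \<omega> \<in> B} | X B.
        adapted T G X \<and> cadlag_paths M T X \<and> B \<in> sets borel}"
  have E: "?E \<subseteq> Pow ({0..T} \<times> space M)" by auto
  show ?thesis
    unfolding optional_process_def
  proof (rule measurableI)
    fix B :: "real set" assume B: "B \<in> sets borel"
    have "(\<lambda>(t, \<omega>). X t \<omega>) -` B \<inter> space (optional_sigma M T G)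
        = {(t, \<omega>) \<in> {0..T} \<times> space M. X t \<omega> \<in> B}"
      unfolding optional_sigma_def using E by auto
    also have "\<dots> \<in> sets (optional_sigma M T G)"
      unfolding optional_sigma_def sets_measure_of[OF E] using ad cadlag B
      by (intro sigma_sets.Basic) blast
    finally show "(\<lambda>(t, \<omega>). X t \<omega>) -` B \<inter> space (optional_sigma M T G) \<in> sets (optional_sigma M T G)" .
  qed simp
qed

text \<open>The section at time \<open>t\<close> pulls the generators of the optional sigma-algebra back into the past at
\<open>t\<close>.\<close>

lemma adapted_of_optional:
  assumes X: "optional_process M T G X"
  shows "adapted T G X"
  unfolding adapted_def
proof
  fix t assume t: "t \<in> {0..T}"
  let ?E = "{{(t, \<omega>) \<in> {0..T} \<times> space M. X t \<omega> \<in> B} | X B.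
        adapted T G X \<and> cadlag_paths M T X \<and> B \<in> sets borel}"
  have "Pair t \<in> G t \<rightarrow>\<^sub>M optional_sigma M T G"
    unfolding optional_sigma_def
  proof (rule measurable_measure_of)
    show "?E \<subseteq> Pow ({0..T} \<times> space M)" by auto
    show "Pair t \<in> space (G t) \<rightarrow> {0..T} \<times> space M" using t by (auto simp: G.space_F)
    fix A assume "A \<in> ?E"
    then obtain Y B where A: "A = {(t, \<omega>) \<in> {0..T} \<times> space M. Y t \<omega> \<in> B}"
      and Y: "adapted T G Y" and B: "B \<in> sets borel" by blast
    have "Pair t -` A \<inter> space (G t) = Y t -` B \<inter> space (G t)"
      using t by (auto simp: A G.space_F)
    also have "\<dots> \<in> sets (G t)" using Y t B by (auto simp: adapted_def intro: measurable_sets)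
    finally show "Pair t -` A \<inter> space (G t) \<in> sets (G t)" .
  qed
  from measurable_compose[OF this X[unfolded optional_process_def]]
  show "X t \<in> borel_measurable (G t)" by simp
qed

lemma counting_control_in:
  assumes \<tau>: "\<tau> \<in> OT"
  shows "counting_control \<tau> \<in> integer_controls M T F m p n"
proof -
  have ad: "adapted T G (counting_control \<tau>)"
    unfolding adapted_def
  proof
    fix t assume "t \<in> {0..T}"
    have "(\<lambda>\<omega>. of_bool (\<tau> i \<omega> \<le> t) :: real) \<in> borel_measurable (G t)" if "i \<in> {1..n}" for i
    proof -
      have "Measurable.pred (G t) (\<lambda>\<omega>. \<tau> i \<omega> \<le> t)"
        using ST_le[OF OT_ST[OF \<tau>, of i], of t] that by (simp add: pred_def G.space_F)
      then show ?thesis unfolding of_bool_def by measurable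
    qed
    then show "counting_control \<tau> t \<in> borel_measurable (G t)"
      unfolding counting_control_def[abs_def] by (rule borel_measurable_sum)
  qed
  have cb: "constant_between M m p (counting_control \<tau>)"
    unfolding constant_between_def
  proof (intro allI impI ballI)
    fix j t \<omega> assume j: "j < m" and t: "t \<in> {p j..<p (Suc j)}" and \<omega>: "\<omega> \<in> space M"
    have "\<tau> i \<omega> \<le> t \<longleftrightarrow> \<tau> i \<omega> \<le> p j" if i: "i \<in> {1..n}" for i
    proof -
      obtain k where k: "k \<le> m" "\<tau> i \<omega> = p k" by (rule OT_grid_index[OF \<tau> \<omega>, of i]) (use i in auto)
      show ?thesis
      proof (cases "k \<le> j")
        case True
        then have "p k \<le> p j" using k j by (simp add: p_le_iff)
        then show ?thesis using k(2) t by simp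
      next
        case False
        then have "p (Suc j) \<le> p k" using k j by (simp add: p_le_iff)
        then show ?thesis using k(2) t by simp
      qed
    qed
    then show "counting_control \<tau> t \<omega> = counting_control \<tau> (p j) \<omega>"
      unfolding counting_control_def by (intro sum.cong) auto
  qed
  have "counting_control \<tau> t \<omega> \<in> {0..real n}" for t \<omega>
    using counting_control_integer[of \<tau> t \<omega>] by auto
  moreover have "mono_on A (\<lambda>t. counting_control \<tau> t \<omega>)" for A \<omega>
    unfolding counting_control_def by (intro mono_onI sum_mono) auto
  ultimately show ?thesis
    using optional_of_constant_between[OF ad cb] cb counting_control_integer
    by (simp add: integer_controls_def monotone_controls_def controls_def)
qed

lemma control_payoff_counting:
  assumes \<tau>: "\<tau> \<in> OT"
  shows "control_payoff M T \<mu>A \<mu>P n f g \<xi> (counting_control \<tau>) = stopping_payoff M \<mu>A \<mu>P n f g \<xi> \<tau>"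
proof -
  have "counting_control \<tau> \<in> controls M T F m p n"
    using counting_control_in[OF \<tau>] by (simp add: integer_controls_def monotone_controls_def)
  then show ?thesis
    unfolding stopping_payoff_eq[OF \<tau>] control_payoff_eq[OF \<open>counting_control \<tau> \<in> controls M T F m p n\<close>]
    by (intro Bochner_Integration.integral_cong refl
        control_gain_eq[OF \<tau>] counting_control_left_value[OF \<tau>])
qed

text \<open>The time at which the control reaches level \<open>i\<close>, or \<open>T\<close> if it does not. The value \<open>T\<close> for indices outside \<open>{1..n}\<close>
is what ordered families require at \<open>n + 1\<close>.\<close>

definition level_times :: "(real \<Rightarrow> 'w \<Rightarrow> real) \<Rightarrow> nat \<Rightarrow> 'w \<Rightarrow> real" where
  "level_times L i \<omega> = (if i \<in> {1..n} then Min (insert T (p ` {j. j \<le> m \<and> real i \<le> L (p j) \<omega>})) else T)"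

lemma level_times_le_iff:
  assumes "i \<in> {1..n}"
  shows "level_times L i \<omega> \<le> t \<longleftrightarrow> T \<le> t \<or> (\<exists>j\<le>m. p j \<le> t \<and> real i \<le> L (p j) \<omega>)"
  using assms by (subst level_times_def) (auto simp: Min_le_iff)

lemma level_times_in:
  assumes L: "L \<in> monotone_controls M T F m p n"
  shows "level_times L \<in> OT"
proof -
  have ad: "adapted T G L" and cb: "constant_between M m p L"
    using L adapted_of_optional by (auto simp: monotone_controls_def controls_def)
  have "level_times L i \<in> ST" if i: "i \<in> {1..n}" for i
  proof (rule ST_I)
    fix \<omega>
    have "level_times L i \<omega> \<in> insert T (p ` {j. j \<le> m \<and> real i \<le> L (p j) \<omega>})"
      using i by (subst level_times_def) (simp only: if_True, intro Min_in, auto)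
    moreover have "insert T (p ` {j. j \<le> m \<and> real i \<le> L (p j) \<omega>}) \<subseteq> p ` {..m}"
      by (auto intro: image_eqI[of _ p m])
    ultimately show "level_times L i \<omega> \<in> p ` {..m}" by (rule subsetD[rotated])
  next
    fix t
    have "{\<omega>\<in>space M. level_times L i \<omega> \<le> t}
        = {\<omega>\<in>space M. T \<le> t} \<union> (\<Union>j\<in>{j. j \<le> m \<and> p j \<le> t}. {\<omega>\<in>space M. real i \<le> L (p j) \<omega>})"
      unfolding level_times_le_iff[OF i] by auto
    also have "\<dots> \<in> sets (G t)"
    proof (intro sets.Un sets.finite_UN)
      show "{\<omega>\<in>space M. T \<le> t} \<in> sets (G t)"
        using sets.top[of "G t"] by (cases "T \<le> t") (auto simp: G.space_F)
      fix j assume "j \<in> {j. j \<le> m \<and> p j \<le> t}"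
      then have "L (p j) \<in> borel_measurable (G t)"
        using ad p_bounds measurable_G_mono[of "L (p j)" "p j" t] by (auto simp: adapted_def)
      then have "{\<omega>\<in>space (G t). real i \<le> L (p j) \<omega>} \<in> sets (G t)" by measurable
      then show "{\<omega>\<in>space M. real i \<le> L (p j) \<omega>} \<in> sets (G t)" by (simp add: G.space_F)
    qed auto
    finally show "{\<omega>\<in>space M. level_times L i \<omega> \<le> t} \<in> sets (G t)" .
  qed
  moreover have "level_times L i \<omega> \<le> level_times L (Suc i) \<omega>" if i: "i \<in> {1..<n}" for i \<omega>
  proof -
    let ?t = "level_times L (Suc i) \<omega>"
    have "T \<le> ?t \<or> (\<exists>j\<le>m. p j \<le> ?t \<and> real (Suc i) \<le> L (p j) \<omega>)"
      using level_times_le_iff[of "Suc i" L \<omega> ?t] i by simp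
    moreover have "real i \<le> x" if "real (Suc i) \<le> x" for x using that by simp
    ultimately have "T \<le> ?t \<or> (\<exists>j\<le>m. p j \<le> ?t \<and> real i \<le> L (p j) \<omega>)" by blast
    then show ?thesis using level_times_le_iff[of i L \<omega> ?t] i by simp
  qed
  ultimately show ?thesis
    by (auto simp: ordered_stopping_times_def level_times_def fun_eq_iff)
qed

text \<open>By monotonicity, the levels that are reached up to the grid point preceding \<open>p l\<close> are those reached at it.\<close>

lemma level_times_less_iff:
  assumes L: "L \<in> monotone_controls M T F m p n" and \<omega>: "\<omega> \<in> space M" and i: "i \<in> {1..n}" and l: "l \<le> m"
  shows "level_times L i \<omega> < p l \<longleftrightarrow> real i \<le> left_value L l \<omega>"
proof (cases l)
  case 0
  have "\<not> level_times L i \<omega> < 0"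
    using ST_bounds[OF OT_ST[OF level_times_in[OF L], of i] \<omega>] i by auto
  then show ?thesis using 0 i by (simp add: left_value_def)
next
  case (Suc k)
  obtain j where j: "j \<le> m" "level_times L i \<omega> = p j"
    by (rule OT_grid_index[OF level_times_in[OF L] \<omega>, of i]) (use i in auto)
  have mono: "L (p j) \<omega> \<le> L (p k) \<omega>" if "j \<le> k" for j
    using L \<omega> that Suc l p_bounds[of j] p_bounds[of k]
    by (auto simp: monotone_controls_def p_le_iff intro: mono_onD)
  have "level_times L i \<omega> < p l \<longleftrightarrow> level_times L i \<omega> \<le> p k"
    using j Suc l by (simp add: p_less_iff p_le_iff less_Suc_eq_le)
  also have "\<dots> \<longleftrightarrow> T \<le> p k \<or> (\<exists>j\<le>m. p j \<le> p k \<and> real i \<le> L (p j) \<omega>)"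
    by (rule level_times_le_iff[OF i])
  also have "\<dots> \<longleftrightarrow> real i \<le> L (p k) \<omega>"
  proof
    assume "T \<le> p k \<or> (\<exists>j\<le>m. p j \<le> p k \<and> real i \<le> L (p j) \<omega>)"
    then obtain j where "j \<le> k" "real i \<le> L (p j) \<omega>"
      using Suc l p_less[of k m] by (auto simp: p_le_iff)
    then show "real i \<le> L (p k) \<omega>" using mono[of j] by linarith
  next
    assume "real i \<le> L (p k) \<omega>"
    then show "T \<le> p k \<or> (\<exists>j\<le>m. p j \<le> p k \<and> real i \<le> L (p j) \<omega>)"
      using Suc l by (intro disjI2 exI[of _ k]) auto
  qed
  finally show ?thesis using Suc by (simp add: left_value_def)
qed

lemma control_left_value_range:
  assumes L: "L \<in> controls M T F m p n" and \<omega>: "\<omega> \<in> space M" and l: "l \<le> m"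
  shows "left_value L l \<omega> \<in> {0..real n}"
  using assms p_bounds[of "l - 1"] by (auto simp: left_value_def controls_def)

lemma integrable_bounded_mult:
  assumes "integrable M h" "b \<in> borel_measurable M" "\<And>\<omega>. \<omega> \<in> space M \<Longrightarrow> \<bar>b \<omega>\<bar> \<le> B"
  shows "integrable M (\<lambda>\<omega>. b \<omega> * h \<omega> :: real)"
proof (rule Bochner_Integration.integrable_bound[where f = "\<lambda>\<omega>. B * h \<omega>"])
  show "integrable M (\<lambda>\<omega>. B * h \<omega>)" using assms(1) by simp
  show "(\<lambda>\<omega>. b \<omega> * h \<omega>) \<in> borel_measurable M" using assms(1,2) by measurable
  show "AE \<omega> in M. norm (b \<omega> * h \<omega>) \<le> norm (B * h \<omega>)"
  proof (rule AE_I2)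
    fix \<omega> assume "\<omega> \<in> space M"
    then have "\<bar>b \<omega>\<bar> \<le> \<bar>B\<bar>" using assms(3) by force
    then show "norm (b \<omega> * h \<omega>) \<le> norm (B * h \<omega>)" by (simp add: abs_mult mult_right_mono)
  qed
qed

lemma measurable_left_value:
  assumes L: "L \<in> controls M T F m p n" and l: "l \<le> m"
  shows "left_value L l \<in> borel_measurable M"
proof (cases "l = 0")
  case False
  have "adapted T G L" using L adapted_of_optional by (auto simp: controls_def)
  then have "L (p (l - 1)) \<in> borel_measurable M"
    using p_bounds[of "l - 1"] l by (auto simp: adapted_def intro: measurable_G_M)
  then show ?thesis using False by (simp add: left_value_def[abs_def])
qed (simp add: left_value_def[abs_def])

lemma integrable_interpolation:
  assumes L: "L \<in> controls M T F m p n" and l: "l \<le> m"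
  shows "integrable M (\<lambda>\<omega>. interpolation n f (p l) \<omega> (left_value L l \<omega>))"
proof -
  note lv = measurable_left_value[OF L l]
  have clip: "(\<lambda>\<omega>. clip n (left_value L l \<omega>)) \<in> borel_measurable M"
    unfolding clip_def using lv by measurable
  show ?thesis
    unfolding interpolation_hat_functions[OF n_pos]
  proof (intro Bochner_Integration.integrable_add Bochner_Integration.integrable_sum)
    fix k assume "k \<in> {1..n}"
    then show "integrable M (\<lambda>\<omega>. max 0 (1 - \<bar>clip n (left_value L l \<omega>) - real k\<bar>) * f k (p l) \<omega>)"
      using f_integrable[of k l] l clip by (intro integrable_bounded_mult[where B = 1]) auto
  next
    have b: "\<bar>left_value L l \<omega> - clip n (left_value L l \<omega>)\<bar> \<le> 1" if "\<omega> \<in> space M" for \<omega>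
      using control_left_value_range[OF L that l] n_pos by (auto simp: clip_def)
    show "integrable M (\<lambda>\<omega>. left_value L l \<omega> - clip n (left_value L l \<omega>))"
      using integrable_bounded_mult[of "\<lambda>_. 1" "\<lambda>\<omega>. left_value L l \<omega> - clip n (left_value L l \<omega>)" 1] b
        borel_measurable_diff[OF lv clip] by simp
  qed
qed

lemma integrable_control_gain:
  assumes L: "L \<in> controls M T F m p n"
  shows "integrable M (control_gain L)"
proof -
  note lv = measurable_left_value[OF L]
  have of_bool_measurable: "(\<lambda>\<omega>. of_bool (P \<omega>) :: real) \<in> borel_measurable M"
    if "Measurable.pred M P" for P
    using that unfolding of_bool_def by measurable
  note interp = integrable_interpolation[OF L]
  have "integrable M (\<lambda>\<omega>. interpolation n f (p l) \<omega> (left_value L l \<omega>) * of_bool (real i \<le> left_value L l \<omega>))"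
    if l: "l \<le> m" for l i
    using integrable_bounded_mult[OF interp[OF l] of_bool_measurable, of "\<lambda>\<omega>. real i \<le> left_value L l \<omega>" 1]
      lv[OF l] by (simp add: mult.commute)
  moreover have "integrable M (\<lambda>\<omega>. g i (p l) \<omega> * of_bool (left_value L l \<omega> < real i))"
    if "i \<in> {1..n}" "l \<le> m" for i l
    using integrable_bounded_mult[OF g_integrable[OF that] of_bool_measurable, of "\<lambda>\<omega>. left_value L l \<omega> < real i" 1]
      lv[OF that(2)] by (simp add: mult.commute)
  ultimately show ?thesis
    unfolding control_gain_def[abs_def]
    by (intro Bochner_Integration.integrable_sum Bochner_Integration.integrable_diff
        integrable_mult_right \<xi>_integrable) auto
qed

lemma control_payoff_level_times:
  assumes L: "L \<in> monotone_controls M T F m p n"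
  shows "control_payoff M T \<mu>A \<mu>P n f g \<xi> L \<le> stopping_payoff M \<mu>A \<mu>P n f g \<xi> (level_times L)"
proof -
  have C: "L \<in> controls M T F m p n" using L by (simp add: monotone_controls_def)
  show ?thesis
    unfolding control_payoff_eq[OF C] stopping_payoff_eq[OF level_times_in[OF L]]
  proof (rule integral_mono[OF integrable_control_gain[OF C] integrable_stopping_gain[OF level_times_in[OF L]]])
    fix \<omega> assume \<omega>: "\<omega> \<in> space M"
    show "control_gain L \<omega> \<le> stopping_gain (level_times L) \<omega>"
      using control_gain_le[OF level_times_in[OF L] \<omega> control_left_value_range[OF C \<omega>]
          level_times_less_iff[OF L \<omega>]] .
  qed
qed


section \<open>Attainment\<close>

text \<open>Ordered families whose value at the index \<open>n + 1\<close> is free, so that this set is closed under limits of the components \<open>1, \<dots>, n\<close>.\<close>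

definition increasing_times :: "(nat \<Rightarrow> 'w \<Rightarrow> real) set" where
  "increasing_times = {\<tau>. (\<forall>i\<in>{1..n}. \<tau> i \<in> ST) \<and> (\<forall>i\<in>{1..<n}. \<forall>\<omega>\<in>space M. \<tau> i \<omega> \<le> \<tau> (Suc i) \<omega>)}"

lemma increasing_times_lattice: "time_lattice M {1..n} (p ` {..m}) increasing_times"
proof
  show "increasing_times \<noteq> {}"
    using ST_T by (auto simp: increasing_times_def intro!: exI[of _ "\<lambda>_ _. T"])
next
  fix \<sigma> \<tau> assume *: "\<sigma> \<in> increasing_times" "\<tau> \<in> increasing_times"
  show "(\<lambda>x \<omega>. max (\<sigma> x \<omega>) (\<tau> x \<omega>)) \<in> increasing_times"
    using * by (fastforce simp: increasing_times_def intro!: ST_max max.mono)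
  show "(\<lambda>x \<omega>. min (\<sigma> x \<omega>) (\<tau> x \<omega>)) \<in> increasing_times"
    using * by (fastforce simp: increasing_times_def intro!: ST_min min.mono)
next
  fix s t assume s: "\<And>k::nat. s k \<in> increasing_times"
    and lim: "\<And>x \<omega>. x \<in> {1..n} \<Longrightarrow> \<omega> \<in> space M \<Longrightarrow> \<forall>\<^sub>F k in sequentially. s k x \<omega> = t x \<omega>"
  have "t i \<in> ST" if "i \<in> {1..n}" for i
    by (rule ST_limit[of "\<lambda>k. s k i"]) (use s lim that in \<open>auto simp: increasing_times_def\<close>)
  moreover have "t i \<omega> \<le> t (Suc i) \<omega>" if i: "i \<in> {1..<n}" and \<omega>: "\<omega> \<in> space M" for i \<omega>
  proof -
    have "\<forall>\<^sub>F k in sequentially. s k i \<omega> = t i \<omega> \<and> s k (Suc i) \<omega> = t (Suc i) \<omega>"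
      using lim[of i \<omega>] lim[of "Suc i" \<omega>] i \<omega> by (intro eventually_conj) auto
    then obtain k where "s k i \<omega> = t i \<omega>" "s k (Suc i) \<omega> = t (Suc i) \<omega>"
      using eventually_happens by force
    then show ?thesis using s[of k] i \<omega> by (force simp: increasing_times_def)
  qed
  ultimately show "t \<in> increasing_times" by (auto simp: increasing_times_def)
next
  fix \<tau> i \<omega> assume "\<tau> \<in> increasing_times" "i \<in> {1..n}" "\<omega> \<in> space M"
  then show "\<tau> i \<omega> \<in> p ` {..m}" using ST_value[of "\<tau> i" \<omega>] by (auto simp: increasing_times_def)
qed (auto simp: increasing_times_def ST_measurable)

text \<open>The share of the \<open>i\<close>-th time in \<open>stopping_gain\<close> after summation by parts; the boundary term at \<open>T\<close> is
divided equally among the \<open>n\<close> agents.\<close>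

definition separate_gain :: "nat \<Rightarrow> real \<Rightarrow> 'w \<Rightarrow> real" where
  "separate_gain i t \<omega> = accrued cP (g i) t \<omega> + real i * accrued cA (f i) t \<omega>
     - real (i - 1) * accrued cA (f (i - 1)) t \<omega> - accrued cA (f n) T \<omega> - \<xi> \<omega>"

lemma stopping_gain_separates:
  assumes "\<tau> \<in> OT"
  shows "stopping_gain \<tau> \<omega> = (\<Sum>i=1..n. separate_gain i (\<tau> i \<omega>) \<omega>)"
proof -
  have "\<tau> (Suc n) \<omega> = T" using assms by (simp add: ordered_stopping_times_def)
  then show ?thesis
    using nested_differences[of "\<lambda>j k. accrued cA (f j) (\<tau> k \<omega>) \<omega>" n]
    unfolding stopping_gain_def separate_gain_def
    by (simp add: sum.distrib sum_subtractf)
qed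

lemma integrable_separate_gain:
  assumes i: "i \<in> {1..n}"
  shows "integrable M (separate_gain i t)"
proof -
  have "integrable M (\<lambda>\<omega>. real (i - 1) * accrued cA (f (i - 1)) t \<omega>)"
  proof (cases "i = 1")
    case False
    then have "i - 1 \<in> {1..n}" using i by auto
    then show ?thesis using integrable_accrued[of "f (i - 1)" cA t] f_integrable[of "i - 1"] by simp
  qed simp
  moreover have "integrable M (accrued cA (f i) t)" "integrable M (accrued cP (g i) t)" "integrable M (accrued cA (f n) T)"
    using integrable_accrued f_integrable g_integrable i n_pos by auto
  ultimately show ?thesis
    unfolding separate_gain_def[abs_def] using \<xi>_integrable by auto
qed

text \<open>The order constraint between consecutive times is preserved by maxima, minima and limits, so the lattice
argument applies to the separated gain.\<close>

lemma optimal_stopping_family_exists: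
  obtains \<tau> where "\<tau> \<in> OT"
    and "\<And>\<sigma>. \<sigma> \<in> OT \<Longrightarrow> stopping_payoff M \<mu>A \<mu>P n f g \<xi> \<sigma> \<le> stopping_payoff M \<mu>A \<mu>P n f g \<xi> \<tau>"
proof -
  interpret I: time_lattice M "{1..n}" "p ` {..m}" increasing_times by (rule increasing_times_lattice)
  have "I.integrable_rewards separate_gain"
    unfolding I.integrable_rewards_def using integrable_separate_gain by blast
  then obtain \<tau> where \<tau>: "\<tau> \<in> increasing_times" "\<And>\<sigma>. \<sigma> \<in> increasing_times \<Longrightarrow> I.reward separate_gain \<sigma> \<le> I.reward separate_gain \<tau>"
    using I.maximiser_exists by blast
  have payoff: "stopping_payoff M \<mu>A \<mu>P n f g \<xi> \<sigma> = I.reward separate_gain \<sigma>" if "\<sigma> \<in> OT" for \<sigma>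
    unfolding stopping_payoff_eq[OF that] I.reward_def stopping_gain_separates[OF that] ..
  let ?\<tau> = "\<tau>(Suc n := (\<lambda>_. T))"
  have OT: "?\<tau> \<in> OT" using \<tau>(1) by (auto simp: ordered_stopping_times_def increasing_times_def)
  have "I.reward separate_gain ?\<tau> = I.reward separate_gain \<tau>"
    unfolding I.reward_def by (intro Bochner_Integration.integral_cong sum.cong refl) auto
  moreover have "\<sigma> \<in> increasing_times" if "\<sigma> \<in> OT" for \<sigma>
    using that by (auto simp: ordered_stopping_times_def increasing_times_def)
  ultimately show thesis using that[OF OT] \<tau>(2) payoff OT by auto
qed


section \<open>Agents\<close>

abbreviation CON :: "(real \<Rightarrow> 'w \<Rightarrow> real) set" where "CON \<equiv> contracts M T F m p \<xi>"
abbreviation best_time :: "(real \<Rightarrow> 'w \<Rightarrow> real) \<Rightarrow> nat \<Rightarrow> 'w \<Rightarrow> real" where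
  "best_time Y i \<equiv> smallest_optimal_time M F m p \<mu>A (f i) Y"
abbreviation optimal :: "(real \<Rightarrow> 'w \<Rightarrow> real) \<Rightarrow> nat \<Rightarrow> ('w \<Rightarrow> real) \<Rightarrow> bool" where
  "optimal Y i \<equiv> optimal_stopping_time M F m p \<mu>A (f i) Y"

lemma integrable_contract: "Y \<in> CON \<Longrightarrow> j \<le> m \<Longrightarrow> integrable M (Y (p j))"
  by (simp add: contracts_def)

lemma integrable_agent_gain:
  assumes "Y \<in> CON" "i \<in> {1..n}" "\<tau> \<in> ST"
  shows "integrable M (\<lambda>\<omega>. agent_gain i Y (\<tau> \<omega>) \<omega>)"
  by (rule integrable_at_ST[OF assms(3)], unfold agent_gain_def[abs_def])
     (use assms integrable_contract integrable_accrued f_integrable in auto)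

lemma optimal_iff:
  assumes "i \<in> {1..n}"
  shows "optimal Y i \<tau> \<longleftrightarrow> \<tau> \<in> ST \<and>
    (\<forall>\<sigma>\<in>ST. (LINT \<omega>|M. agent_gain i Y (\<sigma> \<omega>) \<omega>) \<le> (LINT \<omega>|M. agent_gain i Y (\<tau> \<omega>) \<omega>))"
  unfolding optimal_stopping_time_def using agent_payoff_eq[OF assms] by auto

text \<open>Existence for a single agent is the case of one component. It shows that the description which defines
\<open>smallest_optimal_time\<close> is satisfied by some stopping time, hence by the chosen one.\<close>

lemma best_time:
  assumes Y: "Y \<in> CON" and i: "i \<in> {1..n}"
  shows "optimal Y i (best_time Y i)" and "optimal Y i \<sigma> \<Longrightarrow> AE \<omega> in M. best_time Y i \<omega> \<le> \<sigma> \<omega>"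
proof -
  let ?C = "{\<tau> :: unit \<Rightarrow> 'w \<Rightarrow> real. \<tau> () \<in> ST}"
  let ?H = "\<lambda>(_::unit). agent_gain i Y"
  interpret I: time_lattice M "{()}" "p ` {..m}" ?C
  proof
    show "?C \<noteq> {}" using ST_T by (auto intro!: exI[of _ "\<lambda>_ _. T"])
    fix s t assume "\<And>k. s k \<in> ?C"
      "\<And>x \<omega>. x \<in> {()} \<Longrightarrow> \<omega> \<in> space M \<Longrightarrow> \<forall>\<^sub>F k in sequentially. s k x \<omega> = t x \<omega>"
    then show "t \<in> ?C" using ST_limit[of "\<lambda>k. s k ()" "t ()"] by auto
  qed (auto intro: ST_max ST_min ST_measurable dest: ST_value)
  have reward: "I.reward ?H \<tau> = (LINT \<omega>|M. agent_gain i Y (\<tau> () \<omega>) \<omega>)" for \<tau>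
    by (simp add: I.reward_def)
  have "integrable M (agent_gain i Y s)" if "s \<in> p ` {..m}" for s
    unfolding agent_gain_def[abs_def] using that integrable_contract[OF Y] integrable_accrued f_integrable[OF i]
    by auto
  then have "I.integrable_rewards ?H" by (simp add: I.integrable_rewards_def)
  from I.smallest_maximiser_exists[OF prob_space_axioms this refl]
  obtain \<tau> where \<tau>: "\<tau> \<in> I.maximisers ?H" "\<And>\<sigma>. \<sigma> \<in> I.maximisers ?H \<Longrightarrow> AE \<omega> in M. \<tau> () \<omega> \<le> \<sigma> () \<omega>"
    by blast
  have max_iff: "\<sigma> \<in> I.maximisers ?H \<longleftrightarrow> optimal Y i (\<sigma> ())" for \<sigma>
  proof -
    have "(\<forall>\<rho>\<in>?C. I.reward ?H \<rho> \<le> I.reward ?H \<sigma>)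
      \<longleftrightarrow> (\<forall>\<rho>\<in>ST. (LINT \<omega>|M. agent_gain i Y (\<rho> \<omega>) \<omega>) \<le> (LINT \<omega>|M. agent_gain i Y (\<sigma> () \<omega>) \<omega>))"
      unfolding reward
    proof safe
      fix \<rho> assume "\<forall>\<rho>\<in>?C. (LINT \<omega>|M. agent_gain i Y (\<rho> () \<omega>) \<omega>) \<le> (LINT \<omega>|M. agent_gain i Y (\<sigma> () \<omega>) \<omega>)" "\<rho> \<in> ST"
      then show "(LINT \<omega>|M. agent_gain i Y (\<rho> \<omega>) \<omega>) \<le> (LINT \<omega>|M. agent_gain i Y (\<sigma> () \<omega>) \<omega>)"
        by (auto dest!: bspec[of _ _ "\<lambda>_. \<rho>"])
    qed auto
    then show ?thesis by (simp add: I.maximisers_def optimal_iff[OF i])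
  qed
  have "\<exists>\<tau>. optimal Y i \<tau> \<and> (\<forall>\<sigma>. optimal Y i \<sigma> \<longrightarrow> (AE \<omega> in M. \<tau> \<omega> \<le> \<sigma> \<omega>))"
    using \<tau>(1) \<tau>(2)[of "\<lambda>_. \<sigma>" for \<sigma>] max_iff by (intro exI[of _ "\<tau> ()"]) auto
  from someI_ex[OF this]
  show "optimal Y i (best_time Y i)" "optimal Y i \<sigma> \<Longrightarrow> AE \<omega> in M. best_time Y i \<omega> \<le> \<sigma> \<omega>"
    unfolding smallest_optimal_time_def by auto
qed

text \<open>If agent \<open>i < j\<close> stopped after agent \<open>j\<close> with positive probability, then agent \<open>i\<close> would not lose by
waiting from \<open>\<tau>\<close> to the maximum of both times, and agent \<open>j\<close>, who accrues strictly more, would strictly gain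
by it. This compares arbitrary optimal times, in particular the smallest ones.\<close>

lemma optimal_times_ordered:
  assumes Y: "Y \<in> CON" and ij: "i \<in> {1..n}" "j \<in> {1..n}" "i < j"
    and \<sigma>: "optimal Y i \<sigma>" and \<tau>: "optimal Y j \<tau>"
  shows "AE \<omega> in M. \<sigma> \<omega> \<le> \<tau> \<omega>"
proof -
  have ST: "\<sigma> \<in> ST" "\<tau> \<in> ST" using \<sigma> \<tau> by (auto simp: optimal_stopping_time_def)
  let ?max = "\<lambda>\<omega>. max (\<sigma> \<omega>) (\<tau> \<omega>)" and ?min = "\<lambda>\<omega>. min (\<sigma> \<omega>) (\<tau> \<omega>)"
  have mST: "?max \<in> ST" "?min \<in> ST" using ST_max[OF ST] ST_min[OF ST] by auto
  define D where "D = accrued cA (\<lambda>t \<omega>. f j t \<omega> - f i t \<omega>)"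
  have gain: "agent_gain j Y t \<omega> = agent_gain i Y t \<omega> + D t \<omega>" for t \<omega>
    by (simp add: agent_gain_def D_def accrued_subtract)
  note int = integrable_agent_gain[OF Y]
  let ?d = "\<lambda>\<omega>. D (?max \<omega>) \<omega> - D (\<tau> \<omega>) \<omega>"
  have d_eq: "?d \<omega> = (agent_gain j Y (?max \<omega>) \<omega> - agent_gain j Y (\<tau> \<omega>) \<omega>)
      - (agent_gain i Y (\<sigma> \<omega>) \<omega> - agent_gain i Y (?min \<omega>) \<omega>)" for \<omega>
    by (auto simp: gain max_def min_def)
  have d_int: "integrable M ?d"
    unfolding d_eq using int ij ST mST by (intro Bochner_Integration.integrable_diff) auto
  have strict: "D (\<tau> \<omega>) \<omega> < D (\<sigma> \<omega>) \<omega>" if "\<omega> \<in> space M" "\<tau> \<omega> < \<sigma> \<omega>" for \<omega>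
    unfolding D_def
  proof (rule accrued_strict_mono[OF cA_pos that(2)])
    show "\<sigma> \<omega> \<in> p ` {..m}" using ST_value[OF ST(1) that(1)] .
    show "0 < f j (p l) \<omega> - f i (p l) \<omega>" if "l \<le> m" for l
      using f_less[OF ij that \<open>\<omega> \<in> space M\<close>] by simp
  qed
  have nonneg: "AE \<omega> in M. 0 \<le> ?d \<omega>"
  proof (rule AE_I2)
    fix \<omega> assume "\<omega> \<in> space M"
    then show "0 \<le> ?d \<omega>" using strict[of \<omega>] by (cases "\<tau> \<omega> < \<sigma> \<omega>") (auto simp: max_def)
  qed
  have "(LINT \<omega>|M. ?d \<omega>) = ((LINT \<omega>|M. agent_gain j Y (?max \<omega>) \<omega>) - (LINT \<omega>|M. agent_gain j Y (\<tau> \<omega>) \<omega>))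
      - ((LINT \<omega>|M. agent_gain i Y (\<sigma> \<omega>) \<omega>) - (LINT \<omega>|M. agent_gain i Y (?min \<omega>) \<omega>))"
    unfolding d_eq using int ij ST mST by (simp add: Bochner_Integration.integral_diff)
  also have "\<dots> \<le> 0"
  proof -
    have "(LINT \<omega>|M. agent_gain j Y (?max \<omega>) \<omega>) \<le> (LINT \<omega>|M. agent_gain j Y (\<tau> \<omega>) \<omega>)"
      using bspec[OF conjunct2[OF \<tau>[unfolded optimal_iff[OF ij(2)]]] mST(1)] .
    moreover have "(LINT \<omega>|M. agent_gain i Y (?min \<omega>) \<omega>) \<le> (LINT \<omega>|M. agent_gain i Y (\<sigma> \<omega>) \<omega>)"
      using bspec[OF conjunct2[OF \<sigma>[unfolded optimal_iff[OF ij(1)]]] mST(2)] .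
    ultimately show ?thesis by linarith
  qed
  finally have "(LINT \<omega>|M. ?d \<omega>) = 0" using integral_nonneg_AE[OF nonneg] by simp
  then have "AE \<omega> in M. ?d \<omega> = 0" using integral_nonneg_eq_0_iff_AE[OF d_int nonneg] by simp
  then show ?thesis
  proof (rule AE_mp, intro AE_I2 impI)
    fix \<omega> assume "\<omega> \<in> space M" "?d \<omega> = 0"
    then show "\<sigma> \<omega> \<le> \<tau> \<omega>" using strict[of \<omega>] by (cases "\<tau> \<omega> < \<sigma> \<omega>") (auto simp: max_def)
  qed
qed

lemma stopping_payoff_split:
  assumes \<tau>: "\<tau> \<in> OT"
  shows "stopping_payoff M \<mu>A \<mu>P n f g \<xi> \<tau> = (\<Sum>i=1..n. (LINT \<omega>|M. accrued cP (g i) (\<tau> i \<omega>) \<omega>)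
     - (LINT \<omega>|M. (\<Sum>j=i..n. accrued cA (f j) (\<tau> (Suc j) \<omega>) \<omega> - accrued cA (f j) (\<tau> j \<omega>) \<omega>))
     - (LINT \<omega>|M. \<xi> \<omega>))"
proof -
  have P: "integrable M (\<lambda>\<omega>. accrued cP (g i) (\<tau> i \<omega>) \<omega>)" if "i \<in> {1..n}" for i
    by (rule integrable_at_ST) (use OT_ST[OF \<tau>] integrable_accrued g_integrable that in auto)
  have "integrable M (\<lambda>\<omega>. accrued cA (f j) (\<tau> k \<omega>) \<omega>)" if "j \<in> {1..n}" "k \<in> {1..Suc n}" for j k
    by (rule integrable_at_ST) (use OT_ST[OF \<tau>] integrable_accrued f_integrable that in auto)
  then have A: "integrable M (\<lambda>\<omega>. \<Sum>j=i..n. accrued cA (f j) (\<tau> (Suc j) \<omega>) \<omega> - accrued cA (f j) (\<tau> j \<omega>) \<omega>)"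
    if "i \<in> {1..n}" for i
    using that by (intro Bochner_Integration.integrable_sum Bochner_Integration.integrable_diff) auto
  show ?thesis
    unfolding stopping_payoff_eq[OF \<tau>] stopping_gain_def
    by (subst Bochner_Integration.integral_sum)
       (use P A \<xi>_integrable in \<open>auto simp: Bochner_Integration.integral_diff intro!: sum.cong Bochner_Integration.integrable_diff\<close>)
qed

text \<open>The smallest optimal times are known up to null sets only; any versions of them give the payoff.\<close>

lemma principal_payoff_eq:
  assumes Y: "Y \<in> CON" and \<tau>: "\<And>i. i \<in> {1..n} \<Longrightarrow> \<tau> i \<in> ST"
    and eq: "\<And>i. i \<in> {1..n} \<Longrightarrow> AE \<omega> in M. best_time Y i \<omega> = \<tau> i \<omega>"
  shows "principal_payoff M F m p \<mu>A \<mu>P n f g Y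
    = (\<Sum>i=1..n. (LINT \<omega>|M. accrued cP (g i) (\<tau> i \<omega>) \<omega>) - (LINT \<omega>|M. Y (\<tau> i \<omega>) \<omega>))"
proof -
  let ?R = "\<lambda>i t \<omega>. accrued cP (g i) t \<omega> - Y t \<omega>"
  have best: "best_time Y i \<in> ST" if "i \<in> {1..n}" for i
    using best_time(1)[OF Y that] by (simp add: optimal_stopping_time_def)
  have int_g: "integrable M (\<lambda>\<omega>. accrued cP (g i) (\<sigma> \<omega>) \<omega>)" if "i \<in> {1..n}" "\<sigma> \<in> ST" for i \<sigma>
    by (rule integrable_at_ST) (use that integrable_accrued g_integrable in auto)
  have int_Y: "integrable M (\<lambda>\<omega>. Y (\<sigma> \<omega>) \<omega>)" if "\<sigma> \<in> ST" for \<sigma>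
    by (rule integrable_at_ST) (use that integrable_contract[OF Y] in auto)
  have int: "integrable M (\<lambda>\<omega>. ?R i (\<sigma> \<omega>) \<omega>)" if "i \<in> {1..n}" "\<sigma> \<in> ST" for i \<sigma>
    using int_g[OF that] int_Y[OF that(2)] by auto
  have "principal_payoff M F m p \<mu>A \<mu>P n f g Y = (LINT \<omega>|M. (\<Sum>i=1..n. ?R i (best_time Y i \<omega>) \<omega>))"
    unfolding principal_payoff_def Let_def
  proof (intro Bochner_Integration.integral_cong refl sum.cong)
    fix \<omega> i assume \<omega>: "\<omega> \<in> space M" and i: "i \<in> {1..n}"
    show "(LINT t:{0..best_time Y i \<omega>}|\<mu>P. g i t \<omega>) - Y (best_time Y i \<omega>) \<omega> = ?R i (best_time Y i \<omega>) \<omega>"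
      using integral_accrued[OF cP_pos g_prog[OF i] \<omega>] ST_bounds[OF best[OF i] \<omega>] by simp
  qed
  also have "\<dots> = (\<Sum>i=1..n. LINT \<omega>|M. ?R i (best_time Y i \<omega>) \<omega>)"
    using int best by (intro Bochner_Integration.integral_sum) auto
  also have "\<dots> = (\<Sum>i=1..n. LINT \<omega>|M. ?R i (\<tau> i \<omega>) \<omega>)"
  proof (rule sum.cong[OF refl])
    fix i assume i: "i \<in> {1..n}"
    show "(LINT \<omega>|M. ?R i (best_time Y i \<omega>) \<omega>) = (LINT \<omega>|M. ?R i (\<tau> i \<omega>) \<omega>)"
    proof (rule integral_cong_AE)
      show "AE \<omega> in M. ?R i (best_time Y i \<omega>) \<omega> = ?R i (\<tau> i \<omega>) \<omega>"
        using eq[OF i] by eventually_elim simp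
    qed (use int[OF i best[OF i]] int[OF i \<tau>[OF i]] in auto)
  qed
  also have "\<dots> = (\<Sum>i=1..n. (LINT \<omega>|M. accrued cP (g i) (\<tau> i \<omega>) \<omega>) - (LINT \<omega>|M. Y (\<tau> i \<omega>) \<omega>))"
    using int_g int_Y \<tau> by (intro sum.cong refl Bochner_Integration.integral_diff) auto
  finally show ?thesis .
qed

text \<open>Running maxima turn times that are ordered almost surely into versions that are ordered everywhere.\<close>

lemma running_Max_in:
  assumes s: "\<And>i. i \<in> {1..n} \<Longrightarrow> s i \<in> ST"
  shows "(\<lambda>i \<omega>. if i \<in> {1..n} then Max ((\<lambda>k. s k \<omega>) ` {1..i}) else T) \<in> OT"
proof -
  let ?\<tau> = "\<lambda>i \<omega>. if i \<in> {1..n} then Max ((\<lambda>k. s k \<omega>) ` {1..i}) else T"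
  have "?\<tau> i \<in> ST" if i: "i \<in> {1..n}" for i
  proof (rule ST_I)
    fix \<omega> assume \<omega>: "\<omega> \<in> space M"
    have "Max ((\<lambda>k. s k \<omega>) ` {1..i}) \<in> (\<lambda>k. s k \<omega>) ` {1..i}" using i by (intro Max_in) auto
    then obtain k where "k \<in> {1..i}" "Max ((\<lambda>k. s k \<omega>) ` {1..i}) = s k \<omega>" by auto
    then show "?\<tau> i \<omega> \<in> p ` {..m}" using i ST_value[OF s \<omega>, of k] by auto
  next
    fix t
    have "{\<omega>\<in>space M. ?\<tau> i \<omega> \<le> t} = (\<Inter>k\<in>{1..i}. {\<omega>\<in>space M. s k \<omega> \<le> t})"
      using i by auto
    also have "\<dots> \<in> sets (G t)" using i s by (intro sets.finite_INT ST_le) auto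
    finally show "{\<omega>\<in>space M. ?\<tau> i \<omega> \<le> t} \<in> sets (G t)" .
  qed
  moreover have "?\<tau> i \<omega> \<le> ?\<tau> (Suc i) \<omega>" if "i \<in> {1..<n}" for i \<omega>
    using that by (auto intro!: Max_mono)
  ultimately show ?thesis by (auto simp: ordered_stopping_times_def)
qed

text \<open>The expected payments to successive agents decrease by at least the expected accrual of the earlier agent while
waiting, and the last comparison is with the terminal payment, which is at least \<open>\<xi>\<close>.\<close>

lemma principal_payoff_le:
  assumes Y: "Y \<in> CON"
  obtains \<tau> where "\<tau> \<in> OT" "principal_payoff M F m p \<mu>A \<mu>P n f g Y \<le> stopping_payoff M \<mu>A \<mu>P n f g \<xi> \<tau>"
proof -
  define s where "s = best_time Y"
  define \<tau> where "\<tau> i \<omega> = (if i \<in> {1..n} then Max ((\<lambda>k. s k \<omega>) ` {1..i}) else T)" for i \<omega>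
  have opt: "optimal Y i (s i)" if "i \<in> {1..n}" for i
    using best_time(1)[OF Y that] by (simp add: s_def)
  have sST: "s i \<in> ST" if "i \<in> {1..n}" for i
    using opt[OF that] by (simp add: optimal_stopping_time_def)
  have OT: "\<tau> \<in> OT" using running_Max_in[OF sST] unfolding \<tau>_def[abs_def] .
  have \<tau>ST: "\<tau> i \<in> ST" if "i \<in> {1..Suc n}" for i using OT_ST[OF OT that] .
  have AE_eq: "AE \<omega> in M. s i \<omega> = \<tau> i \<omega>" if i: "i \<in> {1..n}" for i
  proof -
    have "AE \<omega> in M. \<forall>k\<in>{1..i}. s k \<omega> \<le> s i \<omega>"
    proof (rule AE_finite_allI)
      fix k assume k: "k \<in> {1..i}"
      show "AE \<omega> in M. s k \<omega> \<le> s i \<omega>"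
        using optimal_times_ordered[OF Y _ i _ opt opt[OF i], of k] k i by (cases "k = i") auto
    qed simp
    then show ?thesis
    proof eventually_elim
      case (elim \<omega>)
      then have "Max ((\<lambda>k. s k \<omega>) ` {1..i}) = s i \<omega>" using i by (intro Max_eqI) auto
      then show ?case using i by (simp add: \<tau>_def)
    qed
  qed
  have Y_int: "integrable M (\<lambda>\<omega>. Y (\<tau> k \<omega>) \<omega>)" if "k \<in> {1..Suc n}" for k
    by (rule integrable_at_ST) (use that \<tau>ST integrable_contract[OF Y] in auto)
  have f_int: "integrable M (\<lambda>\<omega>. accrued cA (f j) (\<tau> k \<omega>) \<omega>)" if "j \<in> {1..n}" "k \<in> {1..Suc n}" for j k
    by (rule integrable_at_ST) (use \<tau>ST integrable_accrued f_integrable that in auto)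
  define y where "y k = (LINT \<omega>|M. Y (\<tau> k \<omega>) \<omega>)" for k
  define e where "e j = (LINT \<omega>|M. accrued cA (f j) (\<tau> (Suc j) \<omega>) \<omega> - accrued cA (f j) (\<tau> j \<omega>) \<omega>)" for j
  \<comment> \<open>Waiting for agent \<open>j + 1\<close>, or for the final time if \<open>j = n\<close>, does not improve on the optimal time of agent \<open>j\<close>.\<close>
  have step: "y (Suc j) + e j \<le> y j" if j: "j \<in> {1..n}" for j
  proof -
    have "(LINT \<omega>|M. agent_gain j Y (\<tau> (Suc j) \<omega>) \<omega>) \<le> (LINT \<omega>|M. agent_gain j Y (s j \<omega>) \<omega>)"
      using opt[OF j] \<tau>ST[of "Suc j"] j by (auto simp: optimal_iff)
    also have "\<dots> = (LINT \<omega>|M. agent_gain j Y (\<tau> j \<omega>) \<omega>)"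
    proof (rule integral_cong_AE)
      show "AE \<omega> in M. agent_gain j Y (s j \<omega>) \<omega> = agent_gain j Y (\<tau> j \<omega>) \<omega>"
        using AE_eq[OF j] by eventually_elim simp
    qed (use integrable_agent_gain[OF Y j sST[OF j]] integrable_agent_gain[OF Y j \<tau>ST[of j]] j in auto)
    finally show ?thesis
      using Y_int[of j] Y_int[of "Suc j"] f_int[of j j] f_int[of j "Suc j"] j
      by (simp add: agent_gain_def y_def e_def)
  qed
  have telescope: "y (Suc n) + (\<Sum>j=i..n. e j) \<le> y i" if "i \<in> {1..n}" for i
  proof -
    have "i \<le> Suc n" "1 \<le> i" using that by auto
    then show ?thesis
    proof (induction i rule: inc_induct)
      case (step k)
      then have "k \<in> {1..n}" by auto
      moreover have "(\<Sum>j=k..n. e j) = e k + (\<Sum>j=Suc k..n. e j)"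
        using step by (intro sum.atLeast_Suc_atMost) auto
      ultimately show ?case using step.IH \<open>\<And>j. j \<in> {1..n} \<Longrightarrow> y (Suc j) + e j \<le> y j\<close>[of k] by force
    qed simp
  qed
  have terminal: "(LINT \<omega>|M. \<xi> \<omega>) \<le> y (Suc n)"
  proof -
    have "\<tau> (Suc n) = (\<lambda>_. T)" using OT by (simp add: ordered_stopping_times_def)
    then show ?thesis
      using Y integrable_contract[OF Y, of m] \<xi>_integrable
      unfolding y_def by (auto simp: contracts_def intro!: integral_mono)
  qed
  have costs: "(LINT \<omega>|M. (\<Sum>j=i..n. accrued cA (f j) (\<tau> (Suc j) \<omega>) \<omega> - accrued cA (f j) (\<tau> j \<omega>) \<omega>))
      = (\<Sum>j=i..n. e j)" if "i \<in> {1..n}" for i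
    unfolding e_def using that f_int by (intro Bochner_Integration.integral_sum) auto
  have "principal_payoff M F m p \<mu>A \<mu>P n f g Y = (\<Sum>i=1..n. (LINT \<omega>|M. accrued cP (g i) (\<tau> i \<omega>) \<omega>) - y i)"
    unfolding y_def by (rule principal_payoff_eq[OF Y]) (use \<tau>ST AE_eq s_def in auto)
  also have "\<dots> \<le> (\<Sum>i=1..n. (LINT \<omega>|M. accrued cP (g i) (\<tau> i \<omega>) \<omega>) - (\<Sum>j=i..n. e j) - (LINT \<omega>|M. \<xi> \<omega>))"
  proof (rule sum_mono)
    fix i assume "i \<in> {1..n}"
    from telescope[OF this] terminal
    show "(LINT \<omega>|M. accrued cP (g i) (\<tau> i \<omega>) \<omega>) - y i
        \<le> (LINT \<omega>|M. accrued cP (g i) (\<tau> i \<omega>) \<omega>) - (\<Sum>j=i..n. e j) - (LINT \<omega>|M. \<xi> \<omega>)"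
      by linarith
  qed
  also have "\<dots> = stopping_payoff M \<mu>A \<mu>P n f g \<xi> \<tau>"
    unfolding stopping_payoff_split[OF OT] using costs by (intro sum.cong) auto
  finally have "principal_payoff M F m p \<mu>A \<mu>P n f g Y \<le> stopping_payoff M \<mu>A \<mu>P n f g \<xi> \<tau>" .
  then show thesis using that OT by blast
qed


section \<open>Implementing an ordered family of stopping times\<close>

lemma integrable_pay_rate:
  assumes \<tau>: "\<tau> \<in> OT" and l: "l \<le> m"
  shows "integrable M (pay_rate \<tau> (p l))"
proof -
  have "counting_control \<tau> \<in> controls M T F m p n"
    using counting_control_in[OF \<tau>] by (simp add: integer_controls_def monotone_controls_def)
  from integrable_interpolation[OF this l] show ?thesis
    by (rule Bochner_Integration.integrable_cong[THEN iffD1, rotated 2])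
       (auto simp: pay_rate_def counting_control_left_value[OF \<tau> _ l])
qed

text \<open>At such a time fewer than \<open>i\<close> agents have stopped, so the rate is the running payoff of an agent with
smaller index or lies below all running payoffs.\<close>

lemma pay_rate_less:
  assumes \<tau>: "\<tau> \<in> OT" and \<omega>: "\<omega> \<in> space M" and i: "i \<in> {1..n}" and l: "l \<le> m" "p l \<le> \<tau> i \<omega>"
  shows "pay_rate \<tau> (p l) \<omega> < f i (p l) \<omega>"
proof -
  let ?N = "stopped_before n \<tau> (p l) \<omega>"
  have N: "?N < i" using le_stopped_before[OF \<tau> \<omega> i, of "p l"] l by auto
  show ?thesis
  proof (cases "?N = 0")
    case True
    then have "pay_rate \<tau> (p l) \<omega> = f 1 (p l) \<omega> - 1" by (simp add: pay_rate_def interpolation_def)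
    moreover have "f 1 (p l) \<omega> \<le> f i (p l) \<omega>"
      using f_less[of 1 i l \<omega>] i l \<omega> by (cases "i = 1") auto
    ultimately show ?thesis by simp
  next
    case False
    then show ?thesis using pay_rate_eq[of \<tau> "p l" \<omega>] f_less[of ?N i l \<omega>] N i l \<omega> by auto
  qed
qed

lemma pay_rate_ge:
  assumes \<tau>: "\<tau> \<in> OT" and \<omega>: "\<omega> \<in> space M" and i: "i \<in> {1..n}" and l: "l \<le> m" "\<tau> i \<omega> < p l"
  shows "f i (p l) \<omega> \<le> pay_rate \<tau> (p l) \<omega>"
proof -
  let ?N = "stopped_before n \<tau> (p l) \<omega>"
  have N: "i \<le> ?N" "?N \<le> n" using le_stopped_before[OF \<tau> \<omega> i, of "p l"] l stopped_before_le by auto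
  then have "pay_rate \<tau> (p l) \<omega> = f ?N (p l) \<omega>" using pay_rate_eq[of \<tau> "p l" \<omega>] i by auto
  then show ?thesis using f_less[of i ?N l \<omega>] N i l \<omega> by (cases "i = ?N") auto
qed

text \<open>The terminal payment plus the accrual of the pay rate over \<open>(t, T]\<close>; its conditional expectation is the
implementing contract.\<close>

definition remaining_pay :: "(nat \<Rightarrow> 'w \<Rightarrow> real) \<Rightarrow> real \<Rightarrow> 'w \<Rightarrow> real" where
  "remaining_pay \<tau> t \<omega> = \<xi> \<omega> + (accrued cA (pay_rate \<tau>) T \<omega> - accrued cA (pay_rate \<tau>) t \<omega>)"

text \<open>At \<open>T\<close> the conditional expectation is replaced by \<open>\<xi>\<close>, to which it is equal almost surely, since
a contract has to dominate \<open>\<xi>\<close> at every sample point.\<close>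

definition implementing_contract :: "(nat \<Rightarrow> 'w \<Rightarrow> real) \<Rightarrow> real \<Rightarrow> 'w \<Rightarrow> real" where
  "implementing_contract \<tau> t = (if T \<le> t then \<xi> else real_cond_exp M (G t) (remaining_pay \<tau> t))"

lemma integrable_remaining_pay:
  assumes "\<tau> \<in> OT"
  shows "integrable M (remaining_pay \<tau> t)"
  unfolding remaining_pay_def[abs_def]
  using integrable_accrued[of "pay_rate \<tau>" cA] integrable_pay_rate[OF assms] \<xi>_integrable by auto

lemma implementing_contract_in:
  assumes \<tau>: "\<tau> \<in> OT"
  shows "implementing_contract \<tau> \<in> CON"
proof -
  have cond_int: "integrable M (real_cond_exp M (G t) (remaining_pay \<tau> t))" for t
  proof -
    interpret finite_measure_subalgebra M "G t" by unfold_locales (rule subalgebra_G)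
    show ?thesis by (rule real_cond_exp_int(1)[OF integrable_remaining_pay[OF \<tau>]])
  qed
  have "adapted T G (implementing_contract \<tau>)"
    unfolding adapted_def implementing_contract_def
    using \<xi>_measurable grid_filtration_end[OF partition, of F] by auto
  moreover have "constant_between M m p (implementing_contract \<tau>)"
    unfolding constant_between_def
  proof (intro allI impI ballI)
    fix j t \<omega> assume j: "j < m" and t: "t \<in> {p j..<p (Suc j)}" and "\<omega> \<in> space M"
    have "t < T" using t p_bounds(2)[of "Suc j"] j by auto
    moreover have "p j < T" using p_less[of j m] j by simp
    moreover have "G t = G (p j)" using grid_filtration_eq[OF partition j t] G_p[of j] j by simp
    moreover have "remaining_pay \<tau> t = remaining_pay \<tau> (p j)"
    proof -
      have "p l \<le> t \<longleftrightarrow> p l \<le> p j" if "l \<le> m" for l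
        using t j that p_le_iff[of "Suc j" l] p_le_iff[of l j] by (cases "l \<le> j") auto
      then show ?thesis unfolding remaining_pay_def[abs_def] accrued_def by auto
    qed
    ultimately show "implementing_contract \<tau> t \<omega> = implementing_contract \<tau> (p j) \<omega>"
      by (simp add: implementing_contract_def)
  qed
  ultimately show ?thesis
    using \<xi>_integrable cond_int by (auto simp: contracts_def implementing_contract_def)
qed

lemma integral_implementing_contract:
  assumes \<tau>: "\<tau> \<in> OT" and \<sigma>: "\<sigma> \<in> ST"
  shows "(LINT \<omega>|M. implementing_contract \<tau> (\<sigma> \<omega>) \<omega>) = (LINT \<omega>|M. remaining_pay \<tau> (\<sigma> \<omega>) \<omega>)"
proof (rule integral_at_ST_cong[OF \<sigma>])
  show "integrable M (implementing_contract \<tau> (p j))" if "j \<le> m" for j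
    using integrable_contract[OF implementing_contract_in[OF \<tau>] that] .
  show "integrable M (remaining_pay \<tau> (p j))" for j using integrable_remaining_pay[OF \<tau>] .
  fix j A assume j: "j \<le> m" and A: "A \<in> sets (G (p j))"
  interpret finite_measure_subalgebra M "G (p j)" by unfold_locales (rule subalgebra_G)
  show "(LINT \<omega>:A|M. implementing_contract \<tau> (p j) \<omega>) = (LINT \<omega>:A|M. remaining_pay \<tau> (p j) \<omega>)"
  proof (cases "T \<le> p j")
    case True
    then have "p j = T" using p_bounds[OF j] by simp
    then show ?thesis by (simp add: implementing_contract_def remaining_pay_def)
  next
    case False
    then show ?thesis
      using real_cond_exp_intA[OF integrable_remaining_pay[OF \<tau>, of "p j"] A]
      by (simp add: implementing_contract_def)
  qed
qed

text \<open>The first summand does not depend on the stopping time, so agent \<open>i\<close> maximises the expected accrual of \<open>f i\<close> minus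
the pay rate.\<close>

lemma implemented_gain:
  assumes \<tau>: "\<tau> \<in> OT" and i: "i \<in> {1..n}" and \<sigma>: "\<sigma> \<in> ST"
  shows "(LINT \<omega>|M. agent_gain i (implementing_contract \<tau>) (\<sigma> \<omega>) \<omega>)
    = (LINT \<omega>|M. \<xi> \<omega> + accrued cA (pay_rate \<tau>) T \<omega>)
      + (LINT \<omega>|M. accrued cA (\<lambda>t \<omega>. f i t \<omega> - pay_rate \<tau> t \<omega>) (\<sigma> \<omega>) \<omega>)"
    and "integrable M (\<lambda>\<omega>. accrued cA (\<lambda>t \<omega>. f i t \<omega> - pay_rate \<tau> t \<omega>) (\<sigma> \<omega>) \<omega>)"
proof -
  have f: "integrable M (\<lambda>\<omega>. accrued cA (f i) (\<sigma> \<omega>) \<omega>)"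
    by (rule integrable_at_ST[OF \<sigma>]) (use integrable_accrued f_integrable[OF i] in auto)
  have Y: "integrable M (\<lambda>\<omega>. implementing_contract \<tau> (\<sigma> \<omega>) \<omega>)"
    by (rule integrable_at_ST[OF \<sigma>]) (use integrable_contract[OF implementing_contract_in[OF \<tau>]] in auto)
  have Z: "integrable M (\<lambda>\<omega>. remaining_pay \<tau> (\<sigma> \<omega>) \<omega>)"
    by (rule integrable_at_ST[OF \<sigma>]) (use integrable_remaining_pay[OF \<tau>] in auto)
  show D: "integrable M (\<lambda>\<omega>. accrued cA (\<lambda>t \<omega>. f i t \<omega> - pay_rate \<tau> t \<omega>) (\<sigma> \<omega>) \<omega>)"
    by (rule integrable_at_ST[OF \<sigma>, where R = "accrued cA (\<lambda>t \<omega>. f i t \<omega> - pay_rate \<tau> t \<omega>)"], rule integrable_accrued)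
       (use f_integrable[OF i] integrable_pay_rate[OF \<tau>] in auto)
  have C: "integrable M (\<lambda>\<omega>. \<xi> \<omega> + accrued cA (pay_rate \<tau>) T \<omega>)"
    using integrable_accrued[of "pay_rate \<tau>" cA T] integrable_pay_rate[OF \<tau>] \<xi>_integrable by auto
  have "(LINT \<omega>|M. agent_gain i (implementing_contract \<tau>) (\<sigma> \<omega>) \<omega>)
      = (LINT \<omega>|M. accrued cA (f i) (\<sigma> \<omega>) \<omega>) + (LINT \<omega>|M. remaining_pay \<tau> (\<sigma> \<omega>) \<omega>)"
    unfolding agent_gain_def using f Y integral_implementing_contract[OF \<tau> \<sigma>] by simp
  also have "\<dots> = (LINT \<omega>|M. accrued cA (f i) (\<sigma> \<omega>) \<omega> + remaining_pay \<tau> (\<sigma> \<omega>) \<omega>)"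
    using f Z by simp
  also have "\<dots> = (LINT \<omega>|M. (\<xi> \<omega> + accrued cA (pay_rate \<tau>) T \<omega>)
      + accrued cA (\<lambda>t \<omega>. f i t \<omega> - pay_rate \<tau> t \<omega>) (\<sigma> \<omega>) \<omega>)"
    by (intro Bochner_Integration.integral_cong refl) (simp add: remaining_pay_def accrued_subtract)
  also have "\<dots> = (LINT \<omega>|M. \<xi> \<omega> + accrued cA (pay_rate \<tau>) T \<omega>)
      + (LINT \<omega>|M. accrued cA (\<lambda>t \<omega>. f i t \<omega> - pay_rate \<tau> t \<omega>) (\<sigma> \<omega>) \<omega>)"
    by (rule Bochner_Integration.integral_add[OF C D])
  finally show "(LINT \<omega>|M. agent_gain i (implementing_contract \<tau>) (\<sigma> \<omega>) \<omega>)
    = (LINT \<omega>|M. \<xi> \<omega> + accrued cA (pay_rate \<tau>) T \<omega>)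
      + (LINT \<omega>|M. accrued cA (\<lambda>t \<omega>. f i t \<omega> - pay_rate \<tau> t \<omega>) (\<sigma> \<omega>) \<omega>)" .
qed

text \<open>The accrual of \<open>f i\<close> minus the pay rate increases strictly up to \<open>\<tau> i\<close> and does not increase afterwards. So
\<open>\<tau> i\<close> is optimal, and an optimal time that were smaller with positive probability would lose.\<close>

lemma best_time_implementing_contract:
  assumes \<tau>: "\<tau> \<in> OT" and i: "i \<in> {1..n}"
  shows "AE \<omega> in M. best_time (implementing_contract \<tau>) i \<omega> = \<tau> i \<omega>"
proof -
  let ?Y = "implementing_contract \<tau>"
  note Y = implementing_contract_in[OF \<tau>]
  have \<tau>i: "\<tau> i \<in> ST" using OT_ST[OF \<tau>, of i] i by auto
  define W where "W = accrued cA (\<lambda>t \<omega>. f i t \<omega> - pay_rate \<tau> t \<omega>)"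
  have W_int: "integrable M (\<lambda>\<omega>. W (\<sigma> \<omega>) \<omega>)" if "\<sigma> \<in> ST" for \<sigma>
    using implemented_gain(2)[OF \<tau> i that] by (simp add: W_def)
  have strict: "W t \<omega> < W (\<tau> i \<omega>) \<omega>" if \<omega>: "\<omega> \<in> space M" and t: "t < \<tau> i \<omega>" for t \<omega>
    unfolding W_def
  proof (rule accrued_strict_mono[OF cA_pos t ST_value[OF \<tau>i \<omega>]])
    show "0 < f i (p l) \<omega> - pay_rate \<tau> (p l) \<omega>" if "l \<le> m" "p l \<le> \<tau> i \<omega>" for l
      using pay_rate_less[OF \<tau> \<omega> i that] by simp
  qed
  have le: "W t \<omega> \<le> W (\<tau> i \<omega>) \<omega>" if \<omega>: "\<omega> \<in> space M" for t \<omega>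
  proof (cases "t < \<tau> i \<omega>")
    case False
    then have t: "\<tau> i \<omega> \<le> t" by simp
    show ?thesis
      unfolding W_def
    proof (rule accrued_antimono[OF cA_pos t])
      show "f i (p l) \<omega> - pay_rate \<tau> (p l) \<omega> \<le> 0" if "l \<le> m" "\<tau> i \<omega> < p l" for l
        using pay_rate_ge[OF \<tau> \<omega> i that] by simp
    qed
  qed (use strict[OF \<omega>] in \<open>auto intro: less_imp_le\<close>)
  have "(LINT \<omega>|M. W (\<sigma> \<omega>) \<omega>) \<le> (LINT \<omega>|M. W (\<tau> i \<omega>) \<omega>)" if "\<sigma> \<in> ST" for \<sigma>
    using le by (intro integral_mono W_int that \<tau>i) auto
  then have opt: "optimal ?Y i (\<tau> i)"
    unfolding optimal_iff[OF i] W_def using \<tau>i implemented_gain(1)[OF \<tau> i] by auto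
  let ?s = "best_time ?Y i"
  have s: "optimal ?Y i ?s" by (rule best_time(1)[OF Y i])
  then have sST: "?s \<in> ST" by (simp add: optimal_stopping_time_def)
  have d_int: "integrable M (\<lambda>\<omega>. W (\<tau> i \<omega>) \<omega> - W (?s \<omega>) \<omega>)"
    using W_int[OF \<tau>i] W_int[OF sST] by auto
  have nonneg: "AE \<omega> in M. 0 \<le> W (\<tau> i \<omega>) \<omega> - W (?s \<omega>) \<omega>" using le by auto
  have "(LINT \<omega>|M. agent_gain i ?Y (\<tau> i \<omega>) \<omega>) \<le> (LINT \<omega>|M. agent_gain i ?Y (?s \<omega>) \<omega>)"
    using bspec[OF conjunct2[OF s[unfolded optimal_iff[OF i]]] \<tau>i] .
  then have "(LINT \<omega>|M. W (\<tau> i \<omega>) \<omega>) \<le> (LINT \<omega>|M. W (?s \<omega>) \<omega>)"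
    unfolding implemented_gain(1)[OF \<tau> i \<tau>i] implemented_gain(1)[OF \<tau> i sST] W_def by simp
  then have "(LINT \<omega>|M. W (\<tau> i \<omega>) \<omega> - W (?s \<omega>) \<omega>) = 0"
    using integral_nonneg_AE[OF nonneg] W_int[OF \<tau>i] W_int[OF sST] by simp
  then have "AE \<omega> in M. W (\<tau> i \<omega>) \<omega> - W (?s \<omega>) \<omega> = 0"
    using integral_nonneg_eq_0_iff_AE[OF d_int nonneg] by simp
  moreover have "AE \<omega> in M. ?s \<omega> \<le> \<tau> i \<omega>" using best_time(2)[OF Y i opt] .
  ultimately have "AE \<omega> in M. W (\<tau> i \<omega>) \<omega> - W (?s \<omega>) \<omega> = 0 \<and> ?s \<omega> \<le> \<tau> i \<omega>" by eventually_elim simp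
  then show ?thesis
  proof (rule AE_mp, intro AE_I2 impI)
    fix \<omega> assume "\<omega> \<in> space M" "W (\<tau> i \<omega>) \<omega> - W (?s \<omega>) \<omega> = 0 \<and> ?s \<omega> \<le> \<tau> i \<omega>"
    then show "?s \<omega> = \<tau> i \<omega>" using strict[of \<omega> "?s \<omega>"] by force
  qed
qed

text \<open>The expected payment to agent \<open>i\<close> is the expected remaining pay at \<open>\<tau> i\<close>, and this is exactly the
cost of agent \<open>i\<close> in the stopping problem by \<open>pay_rate_sum\<close>.\<close>

lemma principal_payoff_implementing_contract:
  assumes \<tau>: "\<tau> \<in> OT"
  shows "principal_payoff M F m p \<mu>A \<mu>P n f g (implementing_contract \<tau>) = stopping_payoff M \<mu>A \<mu>P n f g \<xi> \<tau>"
proof -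
  have ST: "\<tau> i \<in> ST" if "i \<in> {1..n}" for i using OT_ST[OF \<tau>, of i] that by auto
  have "principal_payoff M F m p \<mu>A \<mu>P n f g (implementing_contract \<tau>)
      = (\<Sum>i=1..n. (LINT \<omega>|M. accrued cP (g i) (\<tau> i \<omega>) \<omega>) - (LINT \<omega>|M. implementing_contract \<tau> (\<tau> i \<omega>) \<omega>))"
    by (rule principal_payoff_eq[OF implementing_contract_in[OF \<tau>] ST best_time_implementing_contract[OF \<tau>]])
  also have "\<dots> = stopping_payoff M \<mu>A \<mu>P n f g \<xi> \<tau>"
    unfolding stopping_payoff_split[OF \<tau>]
  proof (rule sum.cong[OF refl])
    fix i assume i: "i \<in> {1..n}"
    let ?C = "\<lambda>\<omega>. \<Sum>j=i..n. accrued cA (f j) (\<tau> (Suc j) \<omega>) \<omega> - accrued cA (f j) (\<tau> j \<omega>) \<omega>"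
    have costs: "remaining_pay \<tau> (\<tau> i \<omega>) \<omega> = \<xi> \<omega> + ?C \<omega>" if \<omega>: "\<omega> \<in> space M" for \<omega>
    proof -
      have "accrued cA (pay_rate \<tau>) T \<omega> - accrued cA (pay_rate \<tau>) (\<tau> i \<omega>) \<omega>
          = (\<Sum>l\<le>m. cA l * (of_bool (\<tau> i \<omega> < p l) * pay_rate \<tau> (p l) \<omega>))"
        unfolding accrued_def sum_subtractf[symmetric] by (intro sum.cong refl) (auto simp: p_bounds)
      then show ?thesis unfolding remaining_pay_def pay_rate_sum[OF \<tau> \<omega> i] by simp
    qed
    have Z: "integrable M (\<lambda>\<omega>. remaining_pay \<tau> (\<tau> i \<omega>) \<omega>)"
      by (rule integrable_at_ST[OF ST[OF i]]) (use integrable_remaining_pay[OF \<tau>] in auto)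
    have "(LINT \<omega>|M. ?C \<omega>) = (LINT \<omega>|M. remaining_pay \<tau> (\<tau> i \<omega>) \<omega> - \<xi> \<omega>)"
      by (intro Bochner_Integration.integral_cong refl) (simp add: costs)
    then show "(LINT \<omega>|M. accrued cP (g i) (\<tau> i \<omega>) \<omega>) - (LINT \<omega>|M. implementing_contract \<tau> (\<tau> i \<omega>) \<omega>)
      = (LINT \<omega>|M. accrued cP (g i) (\<tau> i \<omega>) \<omega>) - (LINT \<omega>|M. ?C \<omega>) - (LINT \<omega>|M. \<xi> \<omega>)"
      using Z \<xi>_integrable integral_implementing_contract[OF \<tau> ST[OF i]] by simp
  qed
  finally show ?thesis .
qed


section \<open>Equality of the values\<close>

lemma value_equalities:
  shows "principal_value M T F m p \<mu>A \<mu>P n f g \<xi>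
      = (SUP L\<in>monotone_controls M T F m p n. ereal (control_payoff M T \<mu>A \<mu>P n f g \<xi> L))
    \<and> (SUP L\<in>monotone_controls M T F m p n. ereal (control_payoff M T \<mu>A \<mu>P n f g \<xi> L))
      = (SUP L\<in>integer_controls M T F m p n. ereal (control_payoff M T \<mu>A \<mu>P n f g \<xi> L))
    \<and> (SUP L\<in>integer_controls M T F m p n. ereal (control_payoff M T \<mu>A \<mu>P n f g \<xi> L))
      = (SUP \<tau>\<in>OT. ereal (stopping_payoff M \<mu>A \<mu>P n f g \<xi> \<tau>))
    \<and> (\<exists>Y\<in>CON. ereal (principal_payoff M F m p \<mu>A \<mu>P n f g Y) = principal_value M T F m p \<mu>A \<mu>P n f g \<xi>)"
proof -
  let ?P = "principal_value M T F m p \<mu>A \<mu>P n f g \<xi>"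
  let ?L = "SUP L\<in>monotone_controls M T F m p n. ereal (control_payoff M T \<mu>A \<mu>P n f g \<xi> L)"
  let ?LI = "SUP L\<in>integer_controls M T F m p n. ereal (control_payoff M T \<mu>A \<mu>P n f g \<xi> L)"
  let ?S = "SUP \<tau>\<in>OT. ereal (stopping_payoff M \<mu>A \<mu>P n f g \<xi> \<tau>)"
  have L0_L: "?LI \<le> ?L" by (intro SUP_subset_mono) (auto simp: integer_controls_def)
  have L_S: "?L \<le> ?S"
    by (intro SUP_mono) (use control_payoff_level_times level_times_in in force)
  have S_L0: "?S \<le> ?LI"
    by (intro SUP_mono) (use control_payoff_counting counting_control_in in force)
  have P_S: "?P \<le> ?S"
    unfolding principal_value_def
  proof (intro SUP_mono)
    fix Y assume "Y \<in> CON"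
    from principal_payoff_le[OF this]
    show "\<exists>\<tau>\<in>OT. ereal (principal_payoff M F m p \<mu>A \<mu>P n f g Y) \<le> ereal (stopping_payoff M \<mu>A \<mu>P n f g \<xi> \<tau>)"
      by (metis ereal_less_eq(3))
  qed
  have S_P: "?S \<le> ?P"
    unfolding principal_value_def
    by (intro SUP_mono) (use principal_payoff_implementing_contract implementing_contract_in in force)
  obtain \<tau> where \<tau>: "\<tau> \<in> OT"
    and best: "\<And>\<sigma>. \<sigma> \<in> OT \<Longrightarrow> stopping_payoff M \<mu>A \<mu>P n f g \<xi> \<sigma> \<le> stopping_payoff M \<mu>A \<mu>P n f g \<xi> \<tau>"
    by (rule optimal_stopping_family_exists) (rule that)
  have "?S = ereal (stopping_payoff M \<mu>A \<mu>P n f g \<xi> \<tau>)"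
    using \<tau> best by (intro SUP_eqI) auto
  then have "ereal (principal_payoff M F m p \<mu>A \<mu>P n f g (implementing_contract \<tau>)) = ?P"
    using principal_payoff_implementing_contract[OF \<tau>] P_S S_P by simp
  then have "\<exists>Y\<in>CON. ereal (principal_payoff M F m p \<mu>A \<mu>P n f g Y) = ?P"
    using implementing_contract_in[OF \<tau>] by blast
  moreover have "?P = ?L" "?L = ?LI" "?LI = ?S"
    using L0_L L_S S_L0 P_S S_P by (auto intro: antisym order_trans)
  ultimately show ?thesis by blast
qed

end

theorem theorem3p1:
  fixes M :: "'w measure" and F :: "real \<Rightarrow> 'w measure" and T :: real
    and f g :: "nat \<Rightarrow> real \<Rightarrow> 'w \<Rightarrow> real" and \<xi> :: "'w \<Rightarrow> real"
    and n m :: nat and p cA cP :: "nat \<Rightarrow> real"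
  assumes "prob_space M" and "complete_measure M" and "0 < T" and "usual_filtration M T F"
    and "n \<ge> 1"
    and "\<And>i. i \<in> {1..n} \<Longrightarrow> progressively_measurable T F (f i)"
    and "\<And>i. i \<in> {1..n} \<Longrightarrow> progressively_measurable T F (g i)"
    and "\<xi> \<in> borel_measurable (F T)" and "integrable M \<xi>"
    and "partition_of T m p"
    and "\<And>j. j \<le> m \<Longrightarrow> cA j > 0" and "\<And>j. j \<le> m \<Longrightarrow> cP j > 0"
    and "\<And>i j. i \<in> {1..n} \<Longrightarrow> j \<le> m \<Longrightarrow> integrable M (f i (p j))"
    and "\<And>i j. i \<in> {1..n} \<Longrightarrow> j \<le> m \<Longrightarrow> integrable M (g i (p j))"
    and "\<And>i j \<omega>. i \<in> {1..<n} \<Longrightarrow> j \<le> m \<Longrightarrow> \<omega> \<in> space M \<Longrightarrow> f i (p j) \<omega> < f (Suc i) (p j) \<omega>"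
  shows "principal_value M T F m p (grid_measure m p cA) (grid_measure m p cP) n f g \<xi>
      = (SUP L\<in>monotone_controls M T F m p n.
           ereal (control_payoff M T (grid_measure m p cA) (grid_measure m p cP) n f g \<xi> L))
    \<and> (SUP L\<in>monotone_controls M T F m p n.
           ereal (control_payoff M T (grid_measure m p cA) (grid_measure m p cP) n f g \<xi> L))
      = (SUP L\<in>integer_controls M T F m p n.
           ereal (control_payoff M T (grid_measure m p cA) (grid_measure m p cP) n f g \<xi> L))
    \<and> (SUP L\<in>integer_controls M T F m p n.
           ereal (control_payoff M T (grid_measure m p cA) (grid_measure m p cP) n f g \<xi> L))
      = (SUP \<tau>\<in>ordered_stopping_times M T F m p n.
           ereal (stopping_payoff M (grid_measure m p cA) (grid_measure m p cP) n f g \<xi> \<tau>))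
    \<and> (\<exists>Y\<in>contracts M T F m p \<xi>.
           ereal (principal_payoff M F m p (grid_measure m p cA) (grid_measure m p cP) n f g Y)
           = principal_value M T F m p (grid_measure m p cA) (grid_measure m p cP) n f g \<xi>)"
proof -
  interpret contract_problem M F T m p f g \<xi> n cA cP
    by (intro contract_problem.intro partitioned_space.intro partitioned_space_axioms.intro
        contract_problem_axioms.intro) (fact assms)+
  show ?thesis by (rule value_equalities)
qed

end
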